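(* Let $V\in\mathcal C$ be real-valued with $V\ge aV_0+b$ for some $a>0$ and $b\in\mathbb R$, and let $\omega\in\beta\mathbb N\setminus\mathbb N$. If $\mathcal F$ is a nonempty weak-$\star$ closed subset of $\mathcal C^\star$, then $\chi_V^\omega$ achieves a maximum on $\mathcal F$ (possibly $-\infty$), and $$\inf_{\substack{\mathcal U\supseteq\mathcal F\\ \mathcal U\text{ weak-}\star\text{ open}}}\ \lim_{N\to\omega}\frac1{N^2}\log\mu_V^{(N)}(\Gamma^{(N)}(\mathcal U))=\max_{\nu\in\mathcal F}\chi_V^\omega(\nu).$$ In particular, the maximum of $\chi_V^\omega$ over $\mathcal C^\star$ is achieved and equals zero; thus a free Gibbs law for $V$ with respect to $\omega$ (i.e. a maximizer of $\chi_V^\omega$ over $\mathcal C^\star$) exists.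
   Context: Function spaces. A tracial $\mathrm W^*$-algebra $(\mathcal A,\tau)$ is a von Neumann algebra with a faithful normal tracial state. $\mathbb W$ is a set of representatives of the isomorphism classes of tracial $\mathrm W^*$-algebras with separable predual; families indexed by $\mathbb W$ are evaluated on any such algebra (e.g. $(M_N(\mathbb C),\mathrm{tr}_N)$, $\mathrm{tr}_N=\frac1N\mathrm{Tr}$) via isomorphism. For $\mathbf X\in\mathcal A^d$: $\|\mathbf X\|_\alpha=(\sum_j\tau((X_j^*X_j)^{\alpha/2}))^{1/\alpha}$ ($1\le\alpha<\infty$), $\|\mathbf X\|_\infty=\max_j\|X_j\|$. A trace polynomial is a linear combination of formal expressions $p_0\,\mathrm{tr}(p_1)\cdots\mathrm{tr}(p_n)$ with $p_i$ non-commutative polynomials in self-adjoint variables; it is evaluated in $(\mathcal A,\tau)$ by replacing $\mathrm{tr}$ by $\tau$. For a complex-multilinear $\Lambda:\mathcal A^{d_1}\times\dots\times\mathcal A^{d_\ell}\to\mathcal A^{d'}$, $\|\Lambda\|_{\mathscr M^\ell,\mathrm{tr}}$ is the supremum of $\|\Lambda[\mathbf Y_1,\dots,\mathbf Y_\ell]\|_\alpha$ over $\alpha,\alpha_j\in[1,\infty]$ with $1/\alpha=\sum_j1/\alpha_j$ and $\|\mathbf Y_j\|_{\alpha_j}\le1$ (for $\ell=0$: $\|\Lambda\|_\infty$); real-multilinear maps on self-adjoint tuples are extended complex-multilinearly. $C_{\mathrm{tr}}(\mathbb R^{*d},\mathscr M(\mathbb R^{*d_1},\dots,\mathbb R^{*d_\ell}))^{d'}$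 is the set of families $\mathbf f=(\mathbf f^{\mathcal A,\tau})_{(\mathcal A,\tau)\in\mathbb W}$ of maps $\mathcal A_{\mathrm{sa}}^d\times\mathcal A_{\mathrm{sa}}^{d_1}\times\dots\times\mathcal A_{\mathrm{sa}}^{d_\ell}\to\mathcal A^{d'}$, real-multilinear in the last $\ell$ arguments, such that for all $R,\epsilon>0$ there is a $d'$-tuple $\mathbf g$ of trace polynomials, multilinear in the last $\ell$ variables, with $\|\mathbf f-\mathbf g\|_R<\epsilon$, where $\|\mathbf f\|_R=\sup_{(\mathcal A,\tau)}\sup_{\|\mathbf X\|_\infty\le R}\|\mathbf f^{\mathcal A,\tau}(\mathbf X)\|_{\mathscr M^\ell,\mathrm{tr}}$. $C^1_{\mathrm{tr}}(\mathbb R^{*d})$: those $f\in C_{\mathrm{tr}}(\mathbb R^{*d})$ whose directional derivatives exist and are given by some $\partial f\in C_{\mathrm{tr}}(\mathbb R^{*d},\mathscr M(\mathbb R^{*d}))$. A function is bounded (in $BC_{\mathrm{tr}}$) if $\sup_R\|\cdot\|_R<\infty$, with norm this supremum. $\mathrm{tr}(C_{\mathrm{tr}}(\mathbb R^{*d}))$: the scalar-valued functions; $\mathrm{tr}(f)$ is $\mathbf X\mapsto\tau(f(\mathbf X))$. Inequalities between real scalar-valued functions are pointwise on all $(\mathcal A,\tau)$, $\mathbf X$. Entropy. $V_0(\mathbf X)=\frac12\|\mathbf X\|_2^2$. $\mathcal C$ is the Banach space of $f\in\mathrm{tr}(C_{\mathrm{tr}}(\mathbb R^{*d}))$ such that $f/(1+V_0)$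 is bounded and is a limit in $\mathrm{tr}(BC_{\mathrm{tr}}(\mathbb R^{*d}))$ of $f_n/(1+V_0)$, where each $f_n$ is a linear combination of functions $\mathrm{tr}(gh)$ with $g,h\in C^1_{\mathrm{tr}}(\mathbb R^{*d})$ having bounded first derivative; $\|f\|_{\mathcal C}=\|f/(1+V_0)\|_{BC_{\mathrm{tr}}}$. $\mathcal C^\star$ is its Banach dual. For a self-adjoint $d$-tuple $\mathbf X$ in $(\mathcal A,\tau)$, with non-commutative law $\lambda_{\mathbf X}$, let $I(\lambda_{\mathbf X})\in\mathcal C^\star$, $I(\lambda_{\mathbf X})(f)=f^{\mathcal A,\tau}(\mathbf X)$. For $\mathcal U\subseteq\mathcal C^\star$, $\Gamma^{(N)}(\mathcal U)=\{\mathbf X\in M_N(\mathbb C)_{\mathrm{sa}}^d:I(\lambda_{\mathbf X})\in\mathcal U\}$. $\mu_V^{(N)}$ is the probability measure on $M_N(\mathbb C)_{\mathrm{sa}}^d$ with density proportional to $e^{-N^2V^{M_N(\mathbb C),\mathrm{tr}_N}(\mathbf X)}$ with respect to Lebesgue measure. $\chi_V^\omega(\nu)=\inf_{\mathcal U}\lim_{N\to\omega}\frac1{N^2}\log\mu_V^{(N)}(\Gamma^{(N)}(\mathcal U))\in[-\infty,0]$, the infimum over weak-$\star$ open neighborhoods $\mathcal U$ of $\nu$ in $\mathcal C^\star$. $\beta\mathbb N$ is the Stone–Čech compactification of $\mathbb N$. *)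

theory Defs
  imports "HOL-Analysis.Analysis" "HOL-Library.Nonpos_Ints" "HOL-Computational_Algebra.Polynomial"
begin

section \<open>Operators on a separable Hilbert space\<close>

text \<open>
  A bounded operator on \<open>\<ell>\<^sup>2(\<nat>)\<close> is represented by its matrix \<open>a i j = \<langle>\<delta>\<^sub>i, a \<delta>\<^sub>j\<rangle>\<close>.
  A matrix comes from a bounded operator iff the sesquilinear form that it defines on finitely
  supported vectors is bounded on the unit ball, and the bound is then the operator norm.
  Rows and columns of bounded matrices are square summable, so the sums in the product
  of two of them converge absolutely.
\<close>

type_synonym mat_op = "nat \<Rightarrow> nat \<Rightarrow> complex"

definition form_values :: "mat_op \<Rightarrow> real set" where
  "form_values a = {cmod (\<Sum>i<n. \<Sum>j<n. cnj (x i) * a i j * y j) | (n::nat) x y.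
     (\<Sum>i<n. (cmod (x i))\<^sup>2) \<le> 1 \<and> (\<Sum>i<n. (cmod (y i))\<^sup>2) \<le> 1}"

definition bounded_op :: "mat_op \<Rightarrow> bool" where
  "bounded_op a \<longleftrightarrow> bdd_above (form_values a)"

definition op_norm :: "mat_op \<Rightarrow> real" where
  "op_norm a = Sup (form_values a)"

definition op_zero :: mat_op where
  "op_zero = (\<lambda>i j. 0)"

definition op_add :: "mat_op \<Rightarrow> mat_op \<Rightarrow> mat_op" (infixl "+\<^sub>o" 65) where
  "a +\<^sub>o b = (\<lambda>i j. a i j + b i j)"

definition op_diff :: "mat_op \<Rightarrow> mat_op \<Rightarrow> mat_op" (infixl "-\<^sub>o" 65) where
  "a -\<^sub>o b = (\<lambda>i j. a i j - b i j)"

definition op_scale :: "complex \<Rightarrow> mat_op \<Rightarrow> mat_op" (infixr "*\<^sub>o" 75) where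
  "c *\<^sub>o a = (\<lambda>i j. c * a i j)"

definition op_mult :: "mat_op \<Rightarrow> mat_op \<Rightarrow> mat_op" (infixl "\<cdot>\<^sub>o" 70) where
  "a \<cdot>\<^sub>o b = (\<lambda>i j. \<Sum>\<^sub>\<infinity>k. a i k * b k j)"

definition adjoint_op :: "mat_op \<Rightarrow> mat_op" where
  "adjoint_op a = (\<lambda>i j. cnj (a j i))"

definition is_projection :: "mat_op \<Rightarrow> bool" where
  "is_projection e \<longleftrightarrow> bounded_op e \<and> adjoint_op e = e \<and> e \<cdot>\<^sub>o e = e"


section \<open>Tracial von Neumann algebras\<close>

text \<open>
  A Hilbert space \<open>H\<close> of finite or countably infinite dimension is taken to be a closed subspace
  of \<open>\<ell>\<^sup>2(\<nat>)\<close>, given by its projection \<open>e\<close>; its bounded operators are those \<open>a\<close> with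
  \<open>e a = a = a e\<close>, and \<open>e\<close> is the identity operator of \<open>H\<close>.
\<close>

definition ops_on :: "mat_op \<Rightarrow> mat_op set" where
  "ops_on e = {a. bounded_op a \<and> e \<cdot>\<^sub>o a = a \<and> a \<cdot>\<^sub>o e = a}"

definition commutant :: "mat_op \<Rightarrow> mat_op set \<Rightarrow> mat_op set" where
  "commutant e S = {b \<in> ops_on e. \<forall>a\<in>S. a \<cdot>\<^sub>o b = b \<cdot>\<^sub>o a}"

definition von_neumann_algebra :: "mat_op \<Rightarrow> mat_op set \<Rightarrow> bool" where
  "von_neumann_algebra e A \<longleftrightarrow>
     is_projection e \<and> A \<subseteq> ops_on e \<and> (\<forall>a\<in>A. adjoint_op a \<in> A) \<and>
     commutant e (commutant e A) = A"

record walg =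
  unit :: mat_op
  elems :: "mat_op set"
  trc :: "mat_op \<Rightarrow> complex"

definition sa :: "walg \<Rightarrow> mat_op set" where
  "sa A = {x \<in> elems A. adjoint_op x = x}"

definition op_le :: "walg \<Rightarrow> mat_op \<Rightarrow> mat_op \<Rightarrow> bool" where
  "op_le A x y \<longleftrightarrow> (\<exists>z\<in>elems A. y -\<^sub>o x = adjoint_op z \<cdot>\<^sub>o z)"

definition tracial_state :: "walg \<Rightarrow> bool" where
  "tracial_state A \<longleftrightarrow>
     (\<forall>x\<in>elems A. \<forall>y\<in>elems A. trc A (x +\<^sub>o y) = trc A x + trc A y) \<and>
     (\<forall>c. \<forall>x\<in>elems A. trc A (c *\<^sub>o x) = c * trc A x) \<and>
     (\<forall>x\<in>elems A. trc A (adjoint_op x \<cdot>\<^sub>o x) \<in> \<real>\<^sub>\<ge>\<^sub>0) \<and>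
     trc A (unit A) = 1 \<and>
     (\<forall>x\<in>elems A. \<forall>y\<in>elems A. trc A (x \<cdot>\<^sub>o y) = trc A (y \<cdot>\<^sub>o x))"

definition faithful_trace :: "walg \<Rightarrow> bool" where
  "faithful_trace A \<longleftrightarrow>
     (\<forall>x\<in>elems A. trc A (adjoint_op x \<cdot>\<^sub>o x) = 0 \<longrightarrow> x = op_zero)"

text \<open>Normality: the trace preserves suprema of bounded upward directed sets.\<close>

definition normal_trace :: "walg \<Rightarrow> bool" where
  "normal_trace A \<longleftrightarrow>
     (\<forall>D s. D \<noteq> {} \<and> D \<subseteq> sa A \<and>
        (\<forall>x\<in>D. \<forall>y\<in>D. \<exists>z\<in>D. op_le A x z \<and> op_le A y z) \<and>
        s \<in> sa A \<and> (\<forall>x\<in>D. op_le A x s) \<and>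
        (\<forall>t\<in>sa A. (\<forall>x\<in>D. op_le A x t) \<longrightarrow> op_le A s t)
      \<longrightarrow> Re (trc A s) = (SUP x\<in>D. Re (trc A x)))"

text \<open>
  A von Neumann algebra has separable predual iff it can be represented on a separable Hilbert
  space, so every tracial \<open>W\<^sup>*\<close>-algebra with separable predual is isomorphic to an element
  of the following set. An isomorphism class has many elements here. This is harmless:
  functions that are approximated by trace polynomials agree on isomorphic algebras, so families
  indexed by this set and families indexed by a set of representatives correspond to each other.
\<close>

definition WW :: "walg set" where
  "WW = {A. von_neumann_algebra (unit A) (elems A) \<and> tracial_state A \<and>
            faithful_trace A \<and> normal_trace A}"

text \<open>The matrix algebra with normalized trace: the operators on the span of the first \<open>N\<close>
  basis vectors.\<close>

definition matrix_alg :: "nat \<Rightarrow> walg" where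
  "matrix_alg N =
     \<lparr>unit = (\<lambda>i j. if i = j \<and> i < N then 1 else 0),
      elems = {a. \<forall>i j. \<not> (i < N \<and> j < N) \<longrightarrow> a i j = 0},
      trc = (\<lambda>a. (\<Sum>i<N. a i i) / of_nat N)\<rparr>"

text \<open>Tuples are indexed by a finite type \<open>'d\<close>; the number of variables is \<open>CARD('d)\<close>.\<close>

definition tuples :: "walg \<Rightarrow> ('d::finite \<Rightarrow> mat_op) set" where
  "tuples A = {X. \<forall>j. X j \<in> elems A}"

definition sa_tuples :: "walg \<Rightarrow> ('d::finite \<Rightarrow> mat_op) set" where
  "sa_tuples A = {X. \<forall>j. X j \<in> sa A}"


section \<open>Non-commutative \<open>L\<^sup>\<alpha>\<close> norms\<close>

fun op_pow :: "walg \<Rightarrow> mat_op \<Rightarrow> nat \<Rightarrow> mat_op" where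
  "op_pow A h 0 = unit A"
| "op_pow A h (Suc n) = h \<cdot>\<^sub>o op_pow A h n"

definition poly_op :: "walg \<Rightarrow> real poly \<Rightarrow> mat_op \<Rightarrow> mat_op" where
  "poly_op A p h = (\<lambda>i j. \<Sum>k\<le>degree p. of_real (coeff p k) * op_pow A h k i j)"

text \<open>
  Continuous functional calculus for positive \<open>h\<close>: the operator \<open>\<phi>(h)\<close> is the norm
  limit of \<open>p(h)\<close> as the real polynomials \<open>p\<close> tend to \<open>\<phi>\<close> uniformly on
  \<open>[0, \<parallel>h\<parallel>]\<close>, an interval that contains the spectrum of \<open>h\<close>.
\<close>

definition cfc_pos :: "walg \<Rightarrow> (real \<Rightarrow> real) \<Rightarrow> mat_op \<Rightarrow> mat_op" where
  "cfc_pos A \<phi> h = (THE b. b \<in> elems A \<and>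
     (\<forall>\<epsilon>>0. \<forall>p. (\<forall>t\<in>{0..op_norm h}. \<bar>poly p t - \<phi> t\<bar> \<le> \<epsilon>) \<longrightarrow> op_norm (poly_op A p h -\<^sub>o b) \<le> \<epsilon>))"

definition sup_norm :: "('d::finite \<Rightarrow> mat_op) \<Rightarrow> real" where
  "sup_norm X = Max (range (\<lambda>j. op_norm (X j)))"

definition Lnorm :: "walg \<Rightarrow> ereal \<Rightarrow> ('d::finite \<Rightarrow> mat_op) \<Rightarrow> real" where
  "Lnorm A \<alpha> X =
     (if \<alpha> = \<infinity> then sup_norm X
      else let r = real_of_ereal \<alpha> in
        (\<Sum>j\<in>UNIV. Re (trc A (cfc_pos A (\<lambda>t. t powr (r / 2)) (adjoint_op (X j) \<cdot>\<^sub>o X j)))) powr (1 / r))"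

text \<open>Complex-linear extension of a real-linear map on self-adjoint tuples.\<close>

definition complexify :: "(('d::finite \<Rightarrow> mat_op) \<Rightarrow> mat_op) \<Rightarrow> ('d \<Rightarrow> mat_op) \<Rightarrow> mat_op" where
  "complexify \<Lambda> Y =
     \<Lambda> (\<lambda>j. (1/2) *\<^sub>o (Y j +\<^sub>o adjoint_op (Y j))) +\<^sub>o
     \<i> *\<^sub>o \<Lambda> (\<lambda>j. (1 / (2 * \<i>)) *\<^sub>o (Y j -\<^sub>o adjoint_op (Y j)))"

text \<open>
  The norm on multilinear maps, for one argument tuple and values that are
  single operators (\<open>\<ell> = 1\<close>, \<open>d' = 1\<close>); then the condition \<open>1/\<alpha> = \<Sum>\<^sub>j 1/\<alpha>\<^sub>j\<close>
  reads \<open>\<alpha> = \<alpha>\<^sub>1\<close>. The spaces with \<open>\<ell> > 1\<close> or \<open>d' > 1\<close> play no role below.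
\<close>

definition Mnorm :: "walg \<Rightarrow> (('d::finite \<Rightarrow> mat_op) \<Rightarrow> mat_op) \<Rightarrow> ennreal" where
  "Mnorm A \<Lambda> =
     (SUP (\<alpha>, Y)\<in>{(\<alpha>, Y). 1 \<le> \<alpha> \<and> Y \<in> tuples A \<and> Lnorm A \<alpha> Y \<le> 1}.
        ennreal (Lnorm A \<alpha> (\<lambda>_::unit. complexify \<Lambda> Y)))"


section \<open>Trace polynomials\<close>

text \<open>
  Non-commutative polynomials are lists of terms (coefficient, word); a trace polynomial is a
  list of terms \<open>(c, p\<^sub>0, [p\<^sub>1, \<dots>, p\<^sub>n])\<close> standing for \<open>c p\<^sub>0 tr(p\<^sub>1) \<cdots> tr(p\<^sub>n)\<close>.
\<close>

type_synonym 'v nc_poly = "(complex \<times> 'v list) list"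
type_synonym 'v trace_poly = "(complex \<times> 'v nc_poly \<times> 'v nc_poly list) list"

definition word_eval :: "walg \<Rightarrow> ('v \<Rightarrow> mat_op) \<Rightarrow> 'v list \<Rightarrow> mat_op" where
  "word_eval A X w = foldr (\<lambda>v a. X v \<cdot>\<^sub>o a) w (unit A)"

definition nc_eval :: "walg \<Rightarrow> ('v \<Rightarrow> mat_op) \<Rightarrow> 'v nc_poly \<Rightarrow> mat_op" where
  "nc_eval A X p = (\<lambda>i j. \<Sum>(c, w)\<leftarrow>p. c * word_eval A X w i j)"

definition tp_eval :: "'v trace_poly \<Rightarrow> walg \<Rightarrow> ('v \<Rightarrow> mat_op) \<Rightarrow> mat_op" where
  "tp_eval q A X =
     (\<lambda>i j. \<Sum>(c, p0, ps)\<leftarrow>q. c * (\<Prod>p\<leftarrow>ps. trc A (nc_eval A X p)) * nc_eval A X p0 i j)"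


section \<open>Function spaces\<close>

type_synonym 'd op_family = "walg \<Rightarrow> ('d \<Rightarrow> mat_op) \<Rightarrow> mat_op"
type_synonym 'd lin_family = "walg \<Rightarrow> ('d \<Rightarrow> mat_op) \<Rightarrow> ('d \<Rightarrow> mat_op) \<Rightarrow> mat_op"
type_synonym 'd scalar_family = "walg \<Rightarrow> ('d \<Rightarrow> mat_op) \<Rightarrow> complex"

definition fam_ball :: "real \<Rightarrow> (walg \<times> ('d::finite \<Rightarrow> mat_op)) set" where
  "fam_ball R = {(A, X). A \<in> WW \<and> X \<in> sa_tuples A \<and> sup_norm X \<le> R}"

definition Ctr_norm :: "real \<Rightarrow> ('d::finite) op_family \<Rightarrow> ennreal" where
  "Ctr_norm R f = (SUP (A, X)\<in>fam_ball R. ennreal (op_norm (f A X)))"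

definition Ctr1_norm :: "real \<Rightarrow> ('d::finite) lin_family \<Rightarrow> ennreal" where
  "Ctr1_norm R F = (SUP (A, X)\<in>fam_ball R. Mnorm A (F A X))"

definition Ctr :: "('d::finite) op_family set" where
  "Ctr = {f. (\<forall>A\<in>WW. \<forall>X\<in>sa_tuples A. f A X \<in> elems A) \<and>
     (\<forall>R>0. \<forall>\<epsilon>>0. \<exists>q :: 'd trace_poly.
        Ctr_norm R (\<lambda>A X. f A X -\<^sub>o tp_eval q A X) < ennreal \<epsilon>)}"

definition real_linear_family :: "('d::finite) lin_family \<Rightarrow> bool" where
  "real_linear_family F \<longleftrightarrow>
     (\<forall>A\<in>WW. \<forall>X\<in>sa_tuples A.
        (\<forall>Y\<in>sa_tuples A. \<forall>Z\<in>sa_tuples A. F A X (\<lambda>j. Y j +\<^sub>o Z j) = F A X Y +\<^sub>o F A X Z) \<and>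
        (\<forall>c::real. \<forall>Y\<in>sa_tuples A. F A X (\<lambda>j. of_real c *\<^sub>o Y j) = of_real c *\<^sub>o F A X Y))"

text \<open>
  The space \<open>C\<^sub>t\<^sub>r(\<real>\<^sup>*\<^sup>d, \<M>(\<real>\<^sup>*\<^sup>d))\<close>. The variables of the approximating trace polynomials
  are \<open>Inl j\<close> (the variable \<open>X\<^sub>j\<close>) and \<open>Inr j\<close> (the variable \<open>Y\<^sub>j\<close>).
\<close>

definition Ctr1 :: "('d::finite) lin_family set" where
  "Ctr1 = {F. (\<forall>A\<in>WW. \<forall>X\<in>sa_tuples A. \<forall>Y\<in>sa_tuples A. F A X Y \<in> elems A) \<and>
     real_linear_family F \<and>
     (\<forall>R>0. \<forall>\<epsilon>>0. \<exists>q :: ('d + 'd) trace_poly.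
        real_linear_family (\<lambda>A X Y. tp_eval q A (case_sum X Y)) \<and>
        Ctr1_norm R (\<lambda>A X Y. F A X Y -\<^sub>o tp_eval q A (case_sum X Y)) < ennreal \<epsilon>)}"

definition is_derivative :: "('d::finite) op_family \<Rightarrow> 'd lin_family \<Rightarrow> bool" where
  "is_derivative f F \<longleftrightarrow>
     (\<forall>A\<in>WW. \<forall>X\<in>sa_tuples A. \<forall>Y\<in>sa_tuples A.
        ((\<lambda>t::real. op_norm
            ((1 / of_real t) *\<^sub>o (f A (\<lambda>j. X j +\<^sub>o of_real t *\<^sub>o Y j) -\<^sub>o f A X) -\<^sub>o F A X Y))
          \<longlongrightarrow> 0) (at 0))"

definition C1tr :: "('d::finite) op_family set" where
  "C1tr = {f \<in> Ctr. \<exists>F\<in>Ctr1. is_derivative f F}"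

definition bounded_derivative :: "('d::finite) op_family \<Rightarrow> bool" where
  "bounded_derivative f \<longleftrightarrow>
     (\<exists>F\<in>Ctr1. is_derivative f F \<and> (SUP R\<in>{0<..}. Ctr1_norm R F) < \<infinity>)"

text \<open>
  Scalar-valued functions are represented by complex-valued families, which take the value zero
  at arguments that are not self-adjoint tuples of an algebra in \<open>WW\<close>, so that equality of
  functions is equality in HOL.
\<close>

definition restrict_fam :: "('d::finite) scalar_family \<Rightarrow> 'd scalar_family" where
  "restrict_fam f = (\<lambda>A X. if A \<in> WW \<and> X \<in> sa_tuples A then f A X else 0)"

definition as_op_family :: "('d::finite) scalar_family \<Rightarrow> 'd op_family" where
  "as_op_family f = (\<lambda>A X. f A X *\<^sub>o unit A)"

definition trCtr :: "('d::finite) scalar_family set" where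
  "trCtr = {f. restrict_fam f = f \<and> as_op_family f \<in> Ctr}"

definition BC_norm :: "('d::finite) scalar_family \<Rightarrow> ennreal" where
  "BC_norm f = (SUP R\<in>{0<..}. Ctr_norm R (as_op_family f))"

definition trBCtr :: "('d::finite) scalar_family set" where
  "trBCtr = {f \<in> trCtr. BC_norm f < \<infinity>}"

text \<open>\<open>V\<^sub>0(X) = 1/2 \<parallel>X\<parallel>\<^sub>2\<^sup>2\<close>; for \<open>\<alpha> = 2\<close> the power
  \<open>(X\<^sub>j\<^sup>* X\<^sub>j)\<^bsup>\<alpha>/2\<^esup>\<close> is \<open>X\<^sub>j\<^sup>* X\<^sub>j\<close> itself.\<close>

definition V0 :: "walg \<Rightarrow> ('d::finite \<Rightarrow> mat_op) \<Rightarrow> real" where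
  "V0 A X = (1/2) * (\<Sum>j\<in>UNIV. Re (trc A (adjoint_op (X j) \<cdot>\<^sub>o X j)))"

definition over_V0 :: "('d::finite) scalar_family \<Rightarrow> 'd scalar_family" where
  "over_V0 f = (\<lambda>A X. f A X / of_real (1 + V0 A X))"

definition tr_products :: "('d::finite) scalar_family set" where
  "tr_products = {restrict_fam (\<lambda>A X. \<Sum>(c, g, h)\<leftarrow>L. c * trc A (g A X \<cdot>\<^sub>o h A X)) | L.
     \<forall>(c, g, h)\<in>set L. g \<in> C1tr \<and> bounded_derivative g \<and> h \<in> C1tr \<and> bounded_derivative h}"

definition CC :: "('d::finite) scalar_family set" where
  "CC = {f \<in> trCtr. over_V0 f \<in> trBCtr \<and>
     (\<exists>fs :: nat \<Rightarrow> 'd scalar_family.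
        (\<forall>n. fs n \<in> tr_products \<and> over_V0 (fs n) \<in> trBCtr) \<and>
        (\<lambda>n. BC_norm (\<lambda>A X. over_V0 f A X - over_V0 (fs n) A X)) \<longlonglongrightarrow> 0)}"

definition CC_norm :: "('d::finite) scalar_family \<Rightarrow> real" where
  "CC_norm f = enn2real (BC_norm (over_V0 f))"


section \<open>The dual space and free entropy\<close>

text \<open>Functionals are defined on \<open>CC\<close> only, hence \<open>undefined\<close> outside.\<close>

definition CC_dual :: "(('d::finite) scalar_family \<Rightarrow> complex) set" where
  "CC_dual = {\<phi> \<in> extensional CC.
     (\<forall>f\<in>CC. \<forall>g\<in>CC. \<phi> (\<lambda>A X. f A X + g A X) = \<phi> f + \<phi> g) \<and>
     (\<forall>c. \<forall>f\<in>CC. \<phi> (\<lambda>A X. c * f A X) = c * \<phi> f) \<and>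
     (\<exists>K. \<forall>f\<in>CC. cmod (\<phi> f) \<le> K * CC_norm f)}"

text \<open>The weak-\<open>\<star>\<close> topology is that of pointwise convergence on \<open>CC\<close>.\<close>

definition weak_star :: "(('d::finite) scalar_family \<Rightarrow> complex) topology" where
  "weak_star = subtopology (product_topology (\<lambda>_. euclidean) CC) CC_dual"

text \<open>This is \<open>I(\<lambda>\<^sub>X)\<close>: the value \<open>f A X\<close> depends only on the non-commutative law of \<open>X\<close>,
  since \<open>f\<close> is a limit of trace polynomials.\<close>

definition law_functional :: "walg \<Rightarrow> ('d::finite \<Rightarrow> mat_op) \<Rightarrow> 'd scalar_family \<Rightarrow> complex" where
  "law_functional A X = restrict (\<lambda>f. f A X) CC"

definition microstates :: "nat \<Rightarrow> (('d::finite) scalar_family \<Rightarrow> complex) set \<Rightarrow> ('d \<Rightarrow> mat_op) set" where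
  "microstates N \<U> = {X \<in> sa_tuples (matrix_alg N). law_functional (matrix_alg N) X \<in> \<U>}"

text \<open>
  Lebesgue measure on \<open>M\<^sub>N(\<complex>)\<^sub>s\<^sub>a\<^sup>d\<close> (as a measure on all tuples of infinite matrices)
  is the image of Lebesgue measure on \<open>\<real>\<^bsup>dN\<^sup>2\<^esup>\<close> under the parametrization of Hermitian matrices by
  their diagonal and the real and imaginary parts of the entries above it. Its
  normalization is irrelevant, since it cancels in \<open>gibbs_measure\<close>.
\<close>

definition hermitian_of :: "nat \<Rightarrow> ('d \<times> nat \<times> nat \<Rightarrow> real) \<Rightarrow> 'd \<Rightarrow> mat_op" where
  "hermitian_of N x = (\<lambda>k i j.
     if i < N \<and> j < N then
       (if i = j then complex_of_real (x (k, i, i))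
        else if i < j then Complex (x (k, i, j)) (x (k, j, i))
        else Complex (x (k, j, i)) (- x (k, i, j)))
     else 0)"

definition lebesgue_sa :: "nat \<Rightarrow> ('d::finite \<Rightarrow> mat_op) measure" where
  "lebesgue_sa N =
     distr (Pi\<^sub>M (UNIV \<times> {..<N} \<times> {..<N}) (\<lambda>_. lborel)) borel (hermitian_of N)"

definition gibbs_weight :: "('d::finite) scalar_family \<Rightarrow> nat \<Rightarrow> ('d \<Rightarrow> mat_op) \<Rightarrow> ennreal" where
  "gibbs_weight V N X = ennreal (exp (- (real N)\<^sup>2 * Re (V (matrix_alg N) X)))"

definition gibbs_measure :: "('d::finite) scalar_family \<Rightarrow> nat \<Rightarrow> ('d \<Rightarrow> mat_op) measure" where
  "gibbs_measure V N =
     density (lebesgue_sa N)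
       (\<lambda>X. gibbs_weight V N X / (\<integral>\<^sup>+Y. gibbs_weight V N Y \<partial>lebesgue_sa N))"

text \<open>Points of \<open>\<beta>\<nat> \<setminus> \<nat>\<close> are the nonprincipal ultrafilters on \<open>\<nat>\<close>.\<close>

definition nonprincipal_ultrafilter :: "nat filter \<Rightarrow> bool" where
  "nonprincipal_ultrafilter \<omega> \<longleftrightarrow>
     \<omega> \<noteq> bot \<and>
     (\<forall>P. eventually P \<omega> \<or> eventually (\<lambda>n. \<not> P n) \<omega>) \<and>
     (\<forall>m. \<not> eventually (\<lambda>n. n = m) \<omega>)"

definition ext_log :: "real \<Rightarrow> ereal" where
  "ext_log p = (if p \<le> 0 then - \<infinity> else ereal (ln p))"

definition log_rate ::
  "nat filter \<Rightarrow> ('d::finite) scalar_family \<Rightarrow> ('d scalar_family \<Rightarrow> complex) set \<Rightarrow> ereal" where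
  "log_rate \<omega> V \<U> =
     Lim \<omega> (\<lambda>N. ereal (1 / (real N)\<^sup>2) * ext_log (measure (gibbs_measure V N) (microstates N \<U>)))"

definition chi ::
  "nat filter \<Rightarrow> ('d::finite) scalar_family \<Rightarrow> ('d scalar_family \<Rightarrow> complex) \<Rightarrow> ereal" where
  "chi \<omega> V \<nu> = (INF \<U>\<in>{\<U>. openin weak_star \<U> \<and> \<nu> \<in> \<U>}. log_rate \<omega> V \<U>)"

definition free_Gibbs_law ::
  "nat filter \<Rightarrow> ('d::finite) scalar_family \<Rightarrow> ('d scalar_family \<Rightarrow> complex) \<Rightarrow> bool" where
  "free_Gibbs_law \<omega> V \<nu> \<longleftrightarrow> \<nu> \<in> CC_dual \<and> (\<forall>\<nu>'\<in>CC_dual. chi \<omega> V \<nu>' \<le> chi \<omega> V \<nu>)"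

end

theory Submission
  imports Defs "HOL-Probability.Distributions"
begin

text \<open>
  The rate \<open>r(U) = lim 1/N\<^sup>2 log \<mu>(\<Gamma>(U))\<close> is monotone and satisfies \<open>r(U \<union> U') = max (r(U)) (r(U'))\<close>,
  since the factor 2 in the union bound is invisible at speed \<open>N\<^sup>2\<close>. If \<open>V\<^sub>0(X) \<le> K - 1\<close>, then the law of
  \<open>X\<close> lies in the ball of radius \<open>K\<close> of the dual space, which is weak-\<open>\<star>\<close> compact. Comparing the Gibbs
  measure with Gaussian integrals by means of \<open>a V\<^sub>0 + b \<le> V \<le> C (1 + V\<^sub>0)\<close> shows that the rate of the
  complement of this ball tends to \<open>-\<infinity>\<close> as \<open>K\<close> grows. Let \<open>m\<close> be the infimum of \<open>r\<close> over the open
  neighborhoods of \<open>\<F>\<close>. If \<open>\<chi> < m\<close> on all of \<open>\<F>\<close>, then finitely many open sets of rate below \<open>m\<close> cover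
  the compact part of \<open>\<F>\<close> in a large ball, and together with the complement of the ball they form
  a neighborhood of \<open>\<F>\<close> of rate below \<open>m\<close>, a contradiction.
\<close>

section \<open>Bounded operators\<close>

text \<open>Everything lives on the scale N^2. A tuple has CARD('d) * N^2 real coordinates, so in
  the ratio of two Gaussian integrals with different parameters the common constants cancel and a
  factor exponential in N^2 is left, which the decay exp (- N^2 a R / 2) beats once R is large. The
  upper bound on V is automatic: the norm of \<open>CC\<close> is the supremum of |f| / (1 + V0), so
  C can be any positive majorant of \<open>CC_norm V\<close>, and the same inequality bounds the law
  of X by 1 + V0(X) in the dual. The hypotheses on V speak of algebras in \<open>WW\<close>, so the
  matrix algebras have to be shown to belong there, normality of the trace included. This fails for
  N = 0, where the unit has trace 0, but a nonprincipal ultrafilter ignores that index. The limits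
  in the rate exist because every function into a complete linear order converges along an
  ultrafilter, namely to its Limsup. The value -\<infinity> causes no trouble in the contradiction:
  nothing lies strictly below m = -\<infinity>.\<close>

lemma bounded_opI:
  assumes "\<And>n x y. (\<Sum>i<n. (cmod (x i))\<^sup>2) \<le> 1 \<Longrightarrow> (\<Sum>i<n. (cmod (y i))\<^sup>2) \<le> 1 \<Longrightarrow>
    cmod (\<Sum>i<n. \<Sum>j<n. cnj (x i) * a i j * y j) \<le> K"
  shows "bounded_op a" "op_norm a \<le> K"
proof -
  have *: "\<And>v. v \<in> form_values a \<Longrightarrow> v \<le> K"
    using assms by (auto simp: form_values_def)
  then show "bounded_op a" by (auto simp: bounded_op_def bdd_above_def)
  \<comment> \<open>Length n = 0 shows that the supremum is over a nonempty set.\<close>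
  have "0 \<in> form_values a"
    unfolding form_values_def by (rule CollectI, rule exI[of _ 0]) auto
  then show "op_norm a \<le> K" unfolding op_norm_def using * by (intro cSup_least) auto
qed

lemma form_le_op_norm:
  assumes "bounded_op a" "(\<Sum>i<n. (cmod (x i))\<^sup>2) \<le> 1" "(\<Sum>i<n. (cmod (y i))\<^sup>2) \<le> 1"
  shows "cmod (\<Sum>i<n. \<Sum>j<n. cnj (x i) * a i j * y j) \<le> op_norm a"
  unfolding op_norm_def
  by (rule cSup_upper) (use assms in \<open>auto simp: form_values_def bounded_op_def\<close>)

lemma op_norm_nonneg: "bounded_op a \<Longrightarrow> 0 \<le> op_norm a"
  using form_le_op_norm[of a "\<lambda>_. 0" 0 "\<lambda>_. 0"] by simp

lemma op_add_bounded:
  assumes "bounded_op a" "bounded_op b"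
  shows "bounded_op (a +\<^sub>o b)" "op_norm (a +\<^sub>o b) \<le> op_norm a + op_norm b"
proof -
  have "cmod (\<Sum>i<n. \<Sum>j<n. cnj (x i) * (a +\<^sub>o b) i j * y j) \<le> op_norm a + op_norm b"
    if "(\<Sum>i<n. (cmod (x i))\<^sup>2) \<le> 1" "(\<Sum>i<n. (cmod (y i))\<^sup>2) \<le> 1" for n x y
  proof -
    have "(\<Sum>i<n. \<Sum>j<n. cnj (x i) * (a +\<^sub>o b) i j * y j) =
      (\<Sum>i<n. \<Sum>j<n. cnj (x i) * a i j * y j) + (\<Sum>i<n. \<Sum>j<n. cnj (x i) * b i j * y j)"
      by (simp add: op_add_def distrib_left distrib_right sum.distrib)
    also have "cmod \<dots> \<le> cmod (\<Sum>i<n. \<Sum>j<n. cnj (x i) * a i j * y j) +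
      cmod (\<Sum>i<n. \<Sum>j<n. cnj (x i) * b i j * y j)"
      by (rule norm_triangle_ineq)
    also have "\<dots> \<le> op_norm a + op_norm b"
      using form_le_op_norm[OF assms(1) that] form_le_op_norm[OF assms(2) that] by (rule add_mono)
    finally show ?thesis .
  qed
  note bounded_opI[OF this]
  then show "bounded_op (a +\<^sub>o b)" "op_norm (a +\<^sub>o b) \<le> op_norm a + op_norm b" by blast+
qed

lemma op_scale_bounded:
  assumes "bounded_op a"
  shows "bounded_op (c *\<^sub>o a)" "op_norm (c *\<^sub>o a) \<le> cmod c * op_norm a"
proof -
  have "cmod (\<Sum>i<n. \<Sum>j<n. cnj (x i) * (c *\<^sub>o a) i j * y j) \<le> cmod c * op_norm a"
    if "(\<Sum>i<n. (cmod (x i))\<^sup>2) \<le> 1" "(\<Sum>i<n. (cmod (y i))\<^sup>2) \<le> 1" for n x y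
  proof -
    have "(\<Sum>i<n. \<Sum>j<n. cnj (x i) * (c *\<^sub>o a) i j * y j) =
      c * (\<Sum>i<n. \<Sum>j<n. cnj (x i) * a i j * y j)"
      by (simp add: op_scale_def sum_distrib_left mult_ac)
    then show ?thesis
      using form_le_op_norm[OF assms that] by (simp add: norm_mult mult_left_mono)
  qed
  note bounded_opI[OF this]
  then show "bounded_op (c *\<^sub>o a)" "op_norm (c *\<^sub>o a) \<le> cmod c * op_norm a" by blast+
qed

lemma op_diff_bounded:
  assumes "bounded_op a" "bounded_op b"
  shows "bounded_op (a -\<^sub>o b)"
proof -
  have "a -\<^sub>o b = a +\<^sub>o (-1) *\<^sub>o b"
    by (simp add: op_diff_def op_add_def op_scale_def)
  then show ?thesis using op_add_bounded(1) op_scale_bounded(1) assms by presburger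
qed

text \<open>The two vectors in \<open>form_values\<close> have the same length; this allows vectors
  of different lengths to be padded with zeros.\<close>

lemma sum_truncate:
  fixes f :: "nat \<Rightarrow> 'b::comm_monoid_add"
  assumes "n \<le> p"
  shows "(\<Sum>i<p. if i < n then f i else 0) = (\<Sum>i<n. f i)"
proof -
  have "{..<p} \<inter> {i. i < n} = {..<n}" using assms by auto
  then show ?thesis by (simp add: sum.If_cases)
qed

text \<open>Duality: the vector u obtained by applying x from the left is tested against its own
  normalized conjugate, which turns the form into the norm of u. The case u = 0 has to be split
  off.\<close>

lemma row_sum_bound:
  assumes a: "bounded_op a" and x: "(\<Sum>i<n. (cmod (x i))\<^sup>2) \<le> 1"
  shows "(\<Sum>k<m. (cmod (\<Sum>i<n. cnj (x i) * a i k))\<^sup>2) \<le> (op_norm a)\<^sup>2"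
proof -
  define u where "u = (\<lambda>k. \<Sum>i<n. cnj (x i) * a i k)"
  define S where "S = (\<Sum>k<m. (cmod (u k))\<^sup>2)"
  have S0: "S \<ge> 0" unfolding S_def by (simp add: sum_nonneg)
  define p where "p = max n m"
  define x' where "x' = (\<lambda>i. if i < n then x i else 0)"
  define y' where "y' = (\<lambda>k. if k < m then cnj (u k) / of_real (sqrt S) else 0)"
  have "sqrt S \<le> op_norm a"
  proof (cases "S = 0")
    case True
    then show ?thesis using op_norm_nonneg[OF a] by simp
  next
    case False
    have "(\<Sum>i<p. (cmod (x' i))\<^sup>2) = (\<Sum>i<p. if i < n then (cmod (x i))\<^sup>2 else 0)"
      by (intro sum.cong) (auto simp: x'_def)
    then have 1: "(\<Sum>i<p. (cmod (x' i))\<^sup>2) \<le> 1"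
      using x by (simp add: sum_truncate p_def)
    have "(\<Sum>i<p. (cmod (y' i))\<^sup>2) = (\<Sum>k<p. if k < m then (cmod (u k))\<^sup>2 / S else 0)"
      using S0 by (intro sum.cong) (auto simp: y'_def norm_divide power_divide)
    also have "\<dots> = S / S"
      by (simp add: sum_truncate p_def flip: sum_divide_distrib) (simp add: S_def)
    also have "\<dots> = 1" using False by simp
    finally have 2: "(\<Sum>i<p. (cmod (y' i))\<^sup>2) \<le> 1" by simp
    have "(\<Sum>i<p. \<Sum>j<p. cnj (x' i) * a i j * y' j) = (\<Sum>j<p. \<Sum>i<p. cnj (x' i) * a i j * y' j)"
      by (rule sum.swap)
    also have "\<dots> = (\<Sum>j<p. (\<Sum>i<p. if i < n then cnj (x i) * a i j else 0) * y' j)"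
      by (intro sum.cong) (auto simp: sum_distrib_right x'_def intro!: sum.cong)
    also have "\<dots> = (\<Sum>j<p. if j < m then (u j * cnj (u j)) / of_real (sqrt S) else 0)"
      by (intro sum.cong) (auto simp: sum_truncate p_def u_def y'_def)
    also have "\<dots> = of_real S / of_real (sqrt S)"
      by (simp add: sum_truncate p_def complex_norm_square S_def sum_divide_distrib
          del: of_real_power)
    also have "\<dots> = of_real (sqrt S)"
      by (metis S0 of_real_divide real_div_sqrt)
    finally show ?thesis
      using form_le_op_norm[OF a 1 2] S0 by simp
  qed
  then have "(sqrt S)\<^sup>2 \<le> (op_norm a)\<^sup>2" using S0 by (intro power_mono) auto
  then show ?thesis using S0 by (simp add: S_def u_def)
qed

lemma adjoint_op_bounded:
  assumes "bounded_op a"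
  shows "bounded_op (adjoint_op a)" "op_norm (adjoint_op a) \<le> op_norm a"
proof -
  have "cmod (\<Sum>i<n. \<Sum>j<n. cnj (x i) * adjoint_op a i j * y j) \<le> op_norm a"
    if "(\<Sum>i<n. (cmod (x i))\<^sup>2) \<le> 1" "(\<Sum>i<n. (cmod (y i))\<^sup>2) \<le> 1" for n x y
  proof -
    have "cmod (\<Sum>i<n. \<Sum>j<n. cnj (x i) * adjoint_op a i j * y j) =
      cmod (cnj (\<Sum>i<n. \<Sum>j<n. cnj (x i) * adjoint_op a i j * y j))"
      by (rule complex_mod_cnj[symmetric])
    also have "cnj (\<Sum>i<n. \<Sum>j<n. cnj (x i) * adjoint_op a i j * y j) =
      (\<Sum>i<n. \<Sum>j<n. cnj (y j) * a j i * x i)"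
      by (simp add: adjoint_op_def mult_ac)
    also have "\<dots> = (\<Sum>j<n. \<Sum>i<n. cnj (y j) * a j i * x i)" by (rule sum.swap)
    also have "cmod \<dots> \<le> op_norm a" using assms that(2,1) by (rule form_le_op_norm)
    finally show ?thesis .
  qed
  note bounded_opI[OF this]
  then show "bounded_op (adjoint_op a)" "op_norm (adjoint_op a) \<le> op_norm a" by blast+
qed

lemma column_sum_bound:
  assumes b: "bounded_op b" and y: "(\<Sum>j<n. (cmod (y j))\<^sup>2) \<le> 1"
  shows "(\<Sum>k<m. (cmod (\<Sum>j<n. b k j * y j))\<^sup>2) \<le> (op_norm b)\<^sup>2"
proof -
  have "cmod (\<Sum>j<n. b k j * y j) = cmod (\<Sum>j<n. cnj (y j) * adjoint_op b j k)" for k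
    by (subst complex_mod_cnj[symmetric]) (simp add: adjoint_op_def mult_ac)
  then have "(\<Sum>k<m. (cmod (\<Sum>j<n. b k j * y j))\<^sup>2) \<le> (op_norm (adjoint_op b))\<^sup>2"
    using row_sum_bound[OF adjoint_op_bounded(1)[OF b] y] by simp
  also have "\<dots> \<le> (op_norm b)\<^sup>2"
    using adjoint_op_bounded[OF b] op_norm_nonneg by (intro power_mono)
  finally show ?thesis .
qed

lemma norm_entry_le_op_norm:
  assumes "bounded_op a"
  shows "cmod (a i j) \<le> op_norm a"
proof -
  define n where "n = Suc (max i j)"
  define x where "x = (\<lambda>k. if k = i then 1 else 0 :: complex)"
  define y where "y = (\<lambda>k. if k = j then 1 else 0 :: complex)"
  have ij: "i < n" "j < n" by (auto simp: n_def)
  have x2: "\<And>k. (cmod (x k))\<^sup>2 = (if k = i then 1 else 0)" "\<And>k. (cmod (y k))\<^sup>2 = (if k = j then 1 else 0)"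
    by (auto simp: x_def y_def)
  have "(\<Sum>i<n. \<Sum>j<n. cnj (x i) * a i j * y j) = (\<Sum>k<n. if k = i then a k j else 0)"
  proof (intro sum.cong refl)
    fix k
    have "(\<Sum>l<n. cnj (x k) * a k l * y l) = (\<Sum>l<n. if l = j then cnj (x k) * a k l else 0)"
      by (intro sum.cong) (auto simp: y_def)
    then show "(\<Sum>l<n. cnj (x k) * a k l * y l) = (if k = i then a k j else 0)"
      using ij by (simp add: x_def)
  qed
  also have "\<dots> = a i j" using ij by simp
  finally show ?thesis
    using form_le_op_norm[OF assms, of x n y] ij by (simp add: x2)
qed

lemma sum_norm_mult_le:
  assumes "(\<Sum>k<m. (cmod (u k))\<^sup>2) \<le> A\<^sup>2" "(\<Sum>k<m. (cmod (v k))\<^sup>2) \<le> B\<^sup>2" "0 \<le> A" "0 \<le> B"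
  shows "(\<Sum>k<m. cmod (u k * v k)) \<le> A * B"
proof -
  have "(\<Sum>k<m. cmod (u k * v k)) = (\<Sum>k<m. \<bar>cmod (u k)\<bar> * \<bar>cmod (v k)\<bar>)"
    by (simp add: norm_mult)
  also have "\<dots> \<le> L2_set (\<lambda>k. cmod (u k)) {..<m} * L2_set (\<lambda>k. cmod (v k)) {..<m}"
    by (rule L2_set_mult_ineq)
  also have "\<dots> \<le> A * B"
    unfolding L2_set_def using assms by (intro mult_mono real_le_lsqrt) (auto simp: sum_nonneg)
  finally show ?thesis .
qed

text \<open>\<open>infsum\<close> is 0 on families that are not summable, so the entries of a
  product say nothing before summability is known. Testing with basis vectors bounds the square sums
  of row i of a and column j of b, and Cauchy-Schwarz gives absolute convergence.\<close>

lemma op_mult_sums: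
  assumes a: "bounded_op a" and b: "bounded_op b"
  shows "(\<lambda>k. a i k * b k j) sums (a \<cdot>\<^sub>o b) i j"
proof -
  have sc: "(\<Sum>k<Suc l. (cmod (if k = l then 1 else 0))\<^sup>2) \<le> 1" for l
    using sum.delta[of "{..<Suc l}" l "\<lambda>_. 1::real"] by (simp add: if_distrib cong: if_cong)
  have r: "(\<Sum>k<m. (cmod (a i k))\<^sup>2) \<le> (op_norm a)\<^sup>2" for m
  proof -
    have "(\<Sum>l<Suc i. cnj (if l = i then 1 else 0) * a l k) = a i k" for k by simp
    with row_sum_bound[OF a sc[of i], of m] show ?thesis by simp
  qed
  have c: "(\<Sum>k<m. (cmod (b k j))\<^sup>2) \<le> (op_norm b)\<^sup>2" for m
  proof -
    have "(\<Sum>l<Suc j. b k l * (if l = j then 1 else 0)) = b k j" for k by simp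
    with column_sum_bound[OF b sc[of j], of m] show ?thesis by simp
  qed
  have "summable (\<lambda>k. norm (a i k * b k j))"
    by (rule summableI_nonneg_bounded[of _ "op_norm a * op_norm b"])
       (use sum_norm_mult_le[OF r c] op_norm_nonneg a b in auto)
  then have "(\<lambda>k. a i k * b k j) summable_on UNIV"
    by (rule norm_summable_imp_summable_on)
  then have "((\<lambda>k. a i k * b k j) has_sum (a \<cdot>\<^sub>o b) i j) UNIV"
    by (simp add: op_mult_def)
  then show ?thesis by (rule has_sum_imp_sums)
qed

text \<open>By Cauchy-Schwarz the partial sums over the inner index are bounded uniformly in the
  number of terms, and the bound passes to the limit.\<close>

lemma op_mult_bounded:
  assumes a: "bounded_op a" and b: "bounded_op b"
  shows "bounded_op (a \<cdot>\<^sub>o b)"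
proof -
  have "cmod (\<Sum>i<n. \<Sum>j<n. cnj (x i) * (a \<cdot>\<^sub>o b) i j * y j) \<le> op_norm a * op_norm b"
    if x: "(\<Sum>i<n. (cmod (x i))\<^sup>2) \<le> 1" and y: "(\<Sum>i<n. (cmod (y i))\<^sup>2) \<le> 1" for n x y
  proof -
    define u where "u = (\<lambda>k. \<Sum>i<n. cnj (x i) * a i k)"
    define v where "v = (\<lambda>k. \<Sum>j<n. b k j * y j)"
    let ?F = "\<Sum>i<n. \<Sum>j<n. cnj (x i) * (a \<cdot>\<^sub>o b) i j * y j"
    have "(\<lambda>k. \<Sum>i<n. \<Sum>j<n. cnj (x i) * (a i k * b k j) * y j) sums ?F"
      by (intro sums_sum sums_mult sums_mult2 op_mult_sums a b)
    moreover have "(\<Sum>i<n. \<Sum>j<n. cnj (x i) * (a i k * b k j) * y j) = u k * v k" for k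
      by (simp add: u_def v_def sum_product mult.assoc)
    ultimately have *: "(\<lambda>m. \<Sum>k<m. u k * v k) \<longlonglongrightarrow> ?F" by (simp add: sums_def)
    have "cmod (\<Sum>k<m. u k * v k) \<le> op_norm a * op_norm b" for m
    proof -
      have "cmod (\<Sum>k<m. u k * v k) \<le> (\<Sum>k<m. cmod (u k * v k))" by (rule norm_sum)
      also have "\<dots> \<le> op_norm a * op_norm b"
        unfolding u_def v_def
        by (rule sum_norm_mult_le[OF row_sum_bound[OF a x] column_sum_bound[OF b y]])
          (use op_norm_nonneg a b in auto)
      finally show ?thesis .
    qed
    then show ?thesis
      using LIMSEQ_le_const2[OF tendsto_norm[OF *]] by blast
  qed
  then show ?thesis by (rule bounded_opI)
qed

section \<open>The space of test functions is a vector space\<close>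

text \<open>The bicommutant condition puts the scalars into A, since multiples of the unit commute
  with the whole commutant. Thus a scalar function, read as an operator family, takes values in
  A.\<close>

lemma WW_unit:
  assumes "A \<in> WW"
  shows "bounded_op (unit A)" "c *\<^sub>o unit A \<in> elems A"
proof -
  let ?e = "unit A" and ?E = "elems A"
  from assms have vn: "is_projection ?e" "?E \<subseteq> ops_on ?e" "commutant ?e (commutant ?e ?E) = ?E"
    by (auto simp: WW_def von_neumann_algebra_def)
  then show b: "bounded_op ?e" by (simp add: is_projection_def)
  have l: "(c *\<^sub>o x) \<cdot>\<^sub>o y = c *\<^sub>o (x \<cdot>\<^sub>o y)" for x y
    by (simp add: op_mult_def op_scale_def mult.assoc infsum_cmult_right')
  have r: "x \<cdot>\<^sub>o (c *\<^sub>o y) = c *\<^sub>o (x \<cdot>\<^sub>o y)" for x y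
  proof -
    have "x i k * (c * y k j) = c * (x i k * y k j)" for i j k by simp
    then show ?thesis by (simp only: op_mult_def op_scale_def infsum_cmult_right')
  qed
  have "c *\<^sub>o ?e \<in> commutant ?e (commutant ?e ?E)"
    using vn(1) op_scale_bounded(1)[OF b]
    by (auto simp: commutant_def ops_on_def l r is_projection_def)
  with vn(3) show "c *\<^sub>o unit A \<in> elems A" by simp
qed

lemma WW_elems_bounded: "A \<in> WW \<Longrightarrow> x \<in> elems A \<Longrightarrow> bounded_op x"
  by (auto simp: WW_def von_neumann_algebra_def ops_on_def)

lemma sum_list_bounded:
  assumes "\<And>t. t \<in> set ts \<Longrightarrow> bounded_op (F t)"
  shows "bounded_op (\<lambda>i j. \<Sum>t\<leftarrow>ts. F t i j)"
  using assms
proof (induction ts)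
  case Nil
  have "bounded_op (\<lambda>i j. 0)" by (rule bounded_opI(1)[of _ 0]) simp
  then show ?case by simp
next
  case (Cons t ts)
  then have "bounded_op (F t +\<^sub>o (\<lambda>i j. \<Sum>t\<leftarrow>ts. F t i j))"
    by (intro op_add_bounded) auto
  then show ?case by (simp add: op_add_def)
qed

text \<open>\<open>op_norm\<close> is a supremum of reals, and its triangle inequality is available
  for bounded operators only; the estimates between functions and their approximants rest on this
  lemma.\<close>

lemma tp_eval_bounded:
  assumes A: "A \<in> WW" and X: "X \<in> sa_tuples A"
  shows "bounded_op (tp_eval q A X)"
proof -
  have w: "bounded_op (word_eval A X w)" for w
    using A X by (induction w)
      (auto simp: word_eval_def sa_tuples_def sa_def intro!: WW_unit(1) op_mult_bounded intro: WW_elems_bounded)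
  have nc: "bounded_op (nc_eval A X p)" for p
    unfolding nc_eval_def
    using sum_list_bounded[of p "\<lambda>(c, w). c *\<^sub>o word_eval A X w"] op_scale_bounded w
    by (auto simp: op_scale_def case_prod_beta')
  show ?thesis
    unfolding tp_eval_def
    using sum_list_bounded[of q "\<lambda>(c, p0, ps). (c * (\<Prod>p\<leftarrow>ps. trc A (nc_eval A X p))) *\<^sub>o nc_eval A X p0"]
      op_scale_bounded nc
    by (auto simp: op_scale_def case_prod_beta')
qed

lemma tp_eval_append: "tp_eval (p @ q) A X = tp_eval p A X +\<^sub>o tp_eval q A X"
  by (simp add: tp_eval_def op_add_def)

lemma tp_eval_scale: "tp_eval (map (\<lambda>(k, r). (c * k, r)) q) A X = c *\<^sub>o tp_eval q A X"
  by (simp add: tp_eval_def op_scale_def comp_def case_prod_beta' sum_list_const_mult mult.assoc)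

section \<open>Seminorms of families under linear operations\<close>

lemma Ctr_norm_le_iff:
  "Ctr_norm R f \<le> K \<longleftrightarrow>
   (\<forall>A X. A \<in> WW \<longrightarrow> X \<in> sa_tuples A \<longrightarrow> sup_norm X \<le> R \<longrightarrow> ennreal (op_norm (f A X)) \<le> K)"
  by (auto simp: Ctr_norm_def fam_ball_def SUP_le_iff)

text \<open>The sum enters as an equation for h, so that the bound applies to rearranged differences
  such as (f + g) - (p + q).\<close>

lemma Ctr_norm_add_le:
  assumes "\<And>A X. A \<in> WW \<Longrightarrow> X \<in> sa_tuples A \<Longrightarrow> bounded_op (f A X) \<and> bounded_op (g A X)"
    and "\<And>A X. A \<in> WW \<Longrightarrow> X \<in> sa_tuples A \<Longrightarrow> h A X = f A X +\<^sub>o g A X"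
  shows "Ctr_norm R h \<le> Ctr_norm R f + Ctr_norm R g"
  unfolding Ctr_norm_le_iff
proof (intro allI impI)
  fix A and X :: "'a \<Rightarrow> mat_op"
  assume A: "A \<in> WW" "X \<in> sa_tuples A" "sup_norm X \<le> R"
  have "ennreal (op_norm (h A X)) \<le> ennreal (op_norm (f A X)) + ennreal (op_norm (g A X))"
    using op_add_bounded(2)[of "f A X" "g A X"] assms A op_norm_nonneg
    by (simp flip: ennreal_plus add: ennreal_leI)
  also have "\<dots> \<le> Ctr_norm R f + Ctr_norm R g"
    using A Ctr_norm_le_iff[of R f "Ctr_norm R f"] Ctr_norm_le_iff[of R g "Ctr_norm R g"]
    by (intro add_mono) auto
  finally show "ennreal (op_norm (h A X)) \<le> Ctr_norm R f + Ctr_norm R g" .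
qed

lemma Ctr_norm_scale_le:
  assumes "\<And>A X. A \<in> WW \<Longrightarrow> X \<in> sa_tuples A \<Longrightarrow> bounded_op (f A X)"
    and "\<And>A X. A \<in> WW \<Longrightarrow> X \<in> sa_tuples A \<Longrightarrow> h A X = c *\<^sub>o f A X"
  shows "Ctr_norm R h \<le> ennreal (cmod c) * Ctr_norm R f"
  unfolding Ctr_norm_le_iff
proof (intro allI impI)
  fix A and X :: "'a \<Rightarrow> mat_op"
  assume A: "A \<in> WW" "X \<in> sa_tuples A" "sup_norm X \<le> R"
  have "ennreal (op_norm (h A X)) \<le> ennreal (cmod c) * ennreal (op_norm (f A X))"
    using op_scale_bounded(2)[of "f A X" c] assms A op_norm_nonneg
    by (simp flip: ennreal_mult add: ennreal_leI)
  also have "\<dots> \<le> ennreal (cmod c) * Ctr_norm R f"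
    using A Ctr_norm_le_iff[of R f "Ctr_norm R f"] by (intro mult_left_mono) auto
  finally show "ennreal (op_norm (h A X)) \<le> ennreal (cmod c) * Ctr_norm R f" .
qed

lemma as_op_family_bounded: "A \<in> WW \<Longrightarrow> bounded_op (as_op_family f A X)"
  unfolding as_op_family_def by (intro op_scale_bounded WW_unit)

lemma as_op_family_add:
  "as_op_family (\<lambda>A X. f A X + g A X) A X = as_op_family f A X +\<^sub>o as_op_family g A X"
  by (simp add: as_op_family_def op_scale_def op_add_def distrib_right)

lemma as_op_family_scale:
  "as_op_family (\<lambda>A X. c * f A X) A X = c *\<^sub>o as_op_family f A X"
  by (simp add: as_op_family_def op_scale_def mult.assoc)

lemma BC_norm_add_le: "BC_norm (\<lambda>A X. f A X + g A X) \<le> BC_norm f + BC_norm g"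
proof -
  have "Ctr_norm R (as_op_family (\<lambda>A X. f A X + g A X)) \<le> BC_norm f + BC_norm g" if "R > 0" for R
  proof -
    have "Ctr_norm R (as_op_family (\<lambda>A X. f A X + g A X)) \<le>
        Ctr_norm R (as_op_family f) + Ctr_norm R (as_op_family g)"
      by (rule Ctr_norm_add_le) (auto simp: as_op_family_bounded as_op_family_add)
    also have "\<dots> \<le> BC_norm f + BC_norm g"
      unfolding BC_norm_def using that by (intro add_mono SUP_upper) auto
    finally show ?thesis .
  qed
  then show ?thesis by (subst BC_norm_def) (auto intro: SUP_least)
qed

lemma BC_norm_scale_le: "BC_norm (\<lambda>A X. c * f A X) \<le> ennreal (cmod c) * BC_norm f"
proof -
  have "Ctr_norm R (as_op_family (\<lambda>A X. c * f A X)) \<le> ennreal (cmod c) * BC_norm f" if "R > 0" for R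
  proof -
    have "Ctr_norm R (as_op_family (\<lambda>A X. c * f A X)) \<le> ennreal (cmod c) * Ctr_norm R (as_op_family f)"
      by (rule Ctr_norm_scale_le) (auto simp: as_op_family_bounded as_op_family_scale)
    also have "\<dots> \<le> ennreal (cmod c) * BC_norm f"
      unfolding BC_norm_def using that by (intro mult_left_mono SUP_upper) auto
    finally show ?thesis .
  qed
  then show ?thesis by (subst BC_norm_def) (auto intro: SUP_least)
qed

section \<open>Linear operations on limits of trace polynomials\<close>

lemma trCtr_approx:
  assumes "f \<in> trCtr" "R > 0" "e > 0"
  obtains q where "Ctr_norm R (\<lambda>A X. as_op_family f A X -\<^sub>o tp_eval q A X) < ennreal e"
proof -
  have "as_op_family f \<in> Ctr" using assms(1) by (simp add: trCtr_def)
  then have "\<forall>R>0. \<forall>e>0. \<exists>q. Ctr_norm R (\<lambda>A X. as_op_family f A X -\<^sub>o tp_eval q A X) < ennreal e"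
    unfolding Ctr_def mem_Collect_eq by (rule conjunct2)
  with assms(2,3) that show ?thesis by meson
qed

lemma trCtrI:
  assumes "restrict_fam f = f"
    and "\<And>R e. R > 0 \<Longrightarrow> e > 0 \<Longrightarrow>
      \<exists>q. Ctr_norm R (\<lambda>A X. as_op_family f A X -\<^sub>o tp_eval q A X) < ennreal e"
  shows "f \<in> trCtr"
  unfolding trCtr_def Ctr_def mem_Collect_eq using assms(1)
  by (intro conjI allI impI ballI assms) (simp_all add: as_op_family_def WW_unit(2))

lemma trCtr_restrict: "f \<in> trCtr \<Longrightarrow> restrict_fam f = f"
  by (simp add: trCtr_def)

lemma trCtr_add:
  assumes f: "f \<in> trCtr" and g: "g \<in> trCtr"
  shows "(\<lambda>A X. f A X + g A X) \<in> trCtr"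
proof -
  have "\<exists>q. Ctr_norm R (\<lambda>A X. as_op_family (\<lambda>A X. f A X + g A X) A X -\<^sub>o tp_eval q A X) < ennreal e"
    if "R > 0" "e > 0" for R e
  proof -
    from that have e2: "e / 2 > 0" by simp
    obtain p where p: "Ctr_norm R (\<lambda>A X. as_op_family f A X -\<^sub>o tp_eval p A X) < ennreal (e/2)"
      using trCtr_approx[OF f \<open>R > 0\<close> e2] .
    obtain q where q: "Ctr_norm R (\<lambda>A X. as_op_family g A X -\<^sub>o tp_eval q A X) < ennreal (e/2)"
      using trCtr_approx[OF g \<open>R > 0\<close> e2] .
    have "Ctr_norm R (\<lambda>A X. as_op_family (\<lambda>A X. f A X + g A X) A X -\<^sub>o tp_eval (p @ q) A X) \<le>
      Ctr_norm R (\<lambda>A X. as_op_family f A X -\<^sub>o tp_eval p A X) +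
      Ctr_norm R (\<lambda>A X. as_op_family g A X -\<^sub>o tp_eval q A X)"
      by (rule Ctr_norm_add_le)
        (simp add: op_diff_bounded as_op_family_bounded tp_eval_bounded, simp add: as_op_family_add
          tp_eval_append op_add_def op_diff_def fun_eq_iff)
    also have "\<dots> < ennreal (e/2 + e/2)" using p q by (rule add_mono_ennreal)
    also have "e/2 + e/2 = e" by simp
    finally show ?thesis by (rule exI)
  qed
  moreover have "restrict_fam (\<lambda>A X. f A X + g A X) = (\<lambda>A X. restrict_fam f A X + restrict_fam g A X)"
    by (auto simp: restrict_fam_def fun_eq_iff)
  ultimately show ?thesis
    using trCtr_restrict[OF f] trCtr_restrict[OF g] by (intro trCtrI) simp_all
qed

lemma trCtr_scale:
  assumes f: "f \<in> trCtr"
  shows "(\<lambda>A X. c * f A X) \<in> trCtr"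
proof -
  have "\<exists>q. Ctr_norm R (\<lambda>A X. as_op_family (\<lambda>A X. c * f A X) A X -\<^sub>o tp_eval q A X) < ennreal e"
    if "R > 0" "e > 0" for R e
  proof -
    \<comment> \<open>Dividing by \<open>cmod c + 1\<close> instead of \<open>cmod c\<close> covers
      c = 0 as well.\<close>
    from that have e2: "e / (cmod c + 1) > 0" by (simp add: add_nonneg_pos)
    obtain p where p: "Ctr_norm R (\<lambda>A X. as_op_family f A X -\<^sub>o tp_eval p A X) < ennreal (e / (cmod c + 1))"
      using trCtr_approx[OF f \<open>R > 0\<close> e2] .
    let ?q = "map (\<lambda>(k, r). (c * k, r)) p"
    have "Ctr_norm R (\<lambda>A X. as_op_family (\<lambda>A X. c * f A X) A X -\<^sub>o tp_eval ?q A X) \<le>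
      ennreal (cmod c) * Ctr_norm R (\<lambda>A X. as_op_family f A X -\<^sub>o tp_eval p A X)"
      by (rule Ctr_norm_scale_le)
        (simp add: op_diff_bounded as_op_family_bounded tp_eval_bounded, simp add: as_op_family_scale
          tp_eval_scale op_scale_def op_diff_def fun_eq_iff right_diff_distrib)
    also have "\<dots> \<le> ennreal (cmod c) * ennreal (e / (cmod c + 1))"
      using p by (intro mult_left_mono) auto
    also have "\<dots> = ennreal (cmod c * (e / (cmod c + 1)))"
      using e2 by (intro ennreal_mult[symmetric]) auto
    also have "\<dots> < ennreal e"
      using that by (intro ennreal_lessI) (auto simp: pos_divide_less_eq add_nonneg_pos distrib_left)
    finally show ?thesis by (rule exI)
  qed
  moreover have "restrict_fam (\<lambda>A X. c * f A X) = (\<lambda>A X. c * restrict_fam f A X)"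
    by (auto simp: restrict_fam_def fun_eq_iff)
  ultimately show ?thesis
    using trCtr_restrict[OF f] by (intro trCtrI) simp_all
qed

lemma trBCtr_add:
  assumes "f \<in> trBCtr" "g \<in> trBCtr"
  shows "(\<lambda>A X. f A X + g A X) \<in> trBCtr"
  using assms trCtr_add[of f g] BC_norm_add_le[of f g]
  by (auto simp: trBCtr_def intro: order.strict_trans1)

lemma trBCtr_scale:
  assumes "f \<in> trBCtr"
  shows "(\<lambda>A X. c * f A X) \<in> trBCtr"
  using assms trCtr_scale[of f c] BC_norm_scale_le[of c f]
  by (auto simp: trBCtr_def ennreal_mult_less_top intro: order.strict_trans1)

lemma tr_products_add:
  assumes "f \<in> tr_products" "g \<in> tr_products"
  shows "(\<lambda>A X. f A X + g A X) \<in> tr_products"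
proof -
  let ?ok = "\<lambda>L. \<forall>(c::complex, g, h)\<in>set L. g \<in> C1tr \<and> bounded_derivative g \<and> h \<in> C1tr \<and> bounded_derivative h"
  let ?F = "\<lambda>L. restrict_fam (\<lambda>A X. \<Sum>(c, g, h)\<leftarrow>L. c * trc A (g A X \<cdot>\<^sub>o h A X))"
  obtain L M where "f = ?F L" "?ok L" "g = ?F M" "?ok M"
    using assms unfolding tr_products_def by blast
  then have "(\<lambda>A X. f A X + g A X) = ?F (L @ M)" "?ok (L @ M)"
    by (auto simp: restrict_fam_def fun_eq_iff)
  then show ?thesis unfolding tr_products_def by blast
qed

lemma tr_products_scale:
  assumes "f \<in> tr_products"
  shows "(\<lambda>A X. c * f A X) \<in> tr_products"
proof -
  let ?ok = "\<lambda>L. \<forall>(c::complex, g, h)\<in>set L. g \<in> C1tr \<and> bounded_derivative g \<and> h \<in> C1tr \<and> bounded_derivative h"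
  let ?F = "\<lambda>L. restrict_fam (\<lambda>A X. \<Sum>(c, g, h)\<leftarrow>L. c * trc A (g A X \<cdot>\<^sub>o h A X))"
  obtain L where "f = ?F L" "?ok L"
    using assms unfolding tr_products_def by blast
  then have "(\<lambda>A X. c * f A X) = ?F (map (\<lambda>(k, r). (c * k, r)) L)" "?ok (map (\<lambda>(k, r). (c * k, r)) L)"
    by (auto simp: restrict_fam_def fun_eq_iff comp_def case_prod_beta' sum_list_const_mult mult.assoc)
  then show ?thesis unfolding tr_products_def by blast
qed

lemma over_V0_add: "over_V0 (\<lambda>A X. f A X + g A X) = (\<lambda>A X. over_V0 f A X + over_V0 g A X)"
  by (simp add: over_V0_def add_divide_distrib fun_eq_iff)

lemma over_V0_scale: "over_V0 (\<lambda>A X. c * f A X) = (\<lambda>A X. c * over_V0 f A X)"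
  by (simp add: over_V0_def fun_eq_iff)

lemma CC_D:
  assumes "f \<in> CC"
  shows "f \<in> trCtr" "over_V0 f \<in> trBCtr"
  using assms by (simp_all add: CC_def)

lemma CC_approx:
  assumes "f \<in> CC"
  obtains fs where "\<And>n. fs n \<in> tr_products" "\<And>n. over_V0 (fs n) \<in> trBCtr"
    "(\<lambda>n. BC_norm (\<lambda>A X. over_V0 f A X - over_V0 (fs n) A X)) \<longlonglongrightarrow> 0"
proof -
  from assms have "\<exists>fs. (\<forall>n. fs n \<in> tr_products \<and> over_V0 (fs n) \<in> trBCtr) \<and>
    (\<lambda>n. BC_norm (\<lambda>A X. over_V0 f A X - over_V0 (fs n) A X)) \<longlonglongrightarrow> 0"
    unfolding CC_def mem_Collect_eq by (elim conjE)
  then obtain fs where fs: "\<forall>n. fs n \<in> tr_products \<and> over_V0 (fs n) \<in> trBCtr"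
    "(\<lambda>n. BC_norm (\<lambda>A X. over_V0 f A X - over_V0 (fs n) A X)) \<longlonglongrightarrow> 0"
    by (elim exE conjE)
  show ?thesis by (rule that[of fs]) (use fs in simp_all)
qed

lemma CC_I:
  assumes "f \<in> trCtr" "over_V0 f \<in> trBCtr"
    and "\<And>n. fs n \<in> tr_products" "\<And>n. over_V0 (fs n) \<in> trBCtr"
    and "(\<lambda>n. BC_norm (\<lambda>A X. over_V0 f A X - over_V0 (fs n) A X)) \<longlonglongrightarrow> 0"
  shows "f \<in> CC"
  unfolding CC_def mem_Collect_eq using assms by (intro conjI exI[of _ fs] allI) simp_all

text \<open>Elements of \<open>CC_dual\<close> are \<open>undefined\<close> outside
  \<open>CC\<close>. Evaluation at X can be additive, and f + g can index a coordinate of the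
  product topology, only because f + g stays in \<open>CC\<close>.\<close>

lemma CC_add:
  assumes f: "f \<in> CC" and g: "g \<in> CC"
  shows "(\<lambda>A X. f A X + g A X) \<in> CC"
proof -
  obtain fs where fs: "\<And>n. fs n \<in> tr_products" "\<And>n. over_V0 (fs n) \<in> trBCtr"
    "(\<lambda>n. BC_norm (\<lambda>A X. over_V0 f A X - over_V0 (fs n) A X)) \<longlonglongrightarrow> 0"
    by (rule CC_approx[OF f]) blast
  obtain gs where gs: "\<And>n. gs n \<in> tr_products" "\<And>n. over_V0 (gs n) \<in> trBCtr"
    "(\<lambda>n. BC_norm (\<lambda>A X. over_V0 g A X - over_V0 (gs n) A X)) \<longlonglongrightarrow> 0"
    by (rule CC_approx[OF g]) blast
  let ?hs = "\<lambda>n A X. fs n A X + gs n A X"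
  let ?h = "\<lambda>A X. f A X + g A X"
  have le: "BC_norm (\<lambda>A X. over_V0 ?h A X - over_V0 (?hs n) A X) \<le> BC_norm (\<lambda>A X. over_V0 f A X - over_V0 (fs n) A X) + BC_norm (\<lambda>A X. over_V0 g A X - over_V0 (gs n) A X)" for n
    using BC_norm_add_le[of "\<lambda>A X. over_V0 f A X - over_V0 (fs n) A X" "\<lambda>A X. over_V0 g A X - over_V0 (gs n) A X"]
    by (simp add: over_V0_add algebra_simps)
  have "(\<lambda>n. BC_norm (\<lambda>A X. over_V0 f A X - over_V0 (fs n) A X) + BC_norm (\<lambda>A X. over_V0 g A X - over_V0 (gs n) A X)) \<longlonglongrightarrow> 0"
    using tendsto_add[OF fs(3) gs(3)] by simp
  from tendsto_sandwich[OF _ _ tendsto_const this] have "(\<lambda>n. BC_norm (\<lambda>A X. over_V0 ?h A X - over_V0 (?hs n) A X)) \<longlonglongrightarrow> 0"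
    by (simp add: le)
  then show ?thesis
    by (intro CC_I[of _ ?hs]) (simp_all add: f g fs gs over_V0_add tr_products_add trCtr_add trBCtr_add CC_D)
qed

lemma CC_scale:
  assumes f: "f \<in> CC"
  shows "(\<lambda>A X. c * f A X) \<in> CC"
proof -
  obtain fs where fs: "\<And>n. fs n \<in> tr_products" "\<And>n. over_V0 (fs n) \<in> trBCtr"
    "(\<lambda>n. BC_norm (\<lambda>A X. over_V0 f A X - over_V0 (fs n) A X)) \<longlonglongrightarrow> 0"
    by (rule CC_approx[OF f]) blast
  let ?hs = "\<lambda>n A X. c * fs n A X"
  let ?h = "\<lambda>A X. c * f A X"
  have le: "BC_norm (\<lambda>A X. over_V0 ?h A X - over_V0 (?hs n) A X) \<le> ennreal (cmod c) * BC_norm (\<lambda>A X. over_V0 f A X - over_V0 (fs n) A X)" for n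
    using BC_norm_scale_le[of c "\<lambda>A X. over_V0 f A X - over_V0 (fs n) A X"]
    by (simp add: over_V0_scale algebra_simps)
  have "(\<lambda>n. ennreal (cmod c) * BC_norm (\<lambda>A X. over_V0 f A X - over_V0 (fs n) A X)) \<longlonglongrightarrow> 0"
    using ennreal_tendsto_cmult[OF _ fs(3), of "ennreal (cmod c)"] by simp
  from tendsto_sandwich[OF _ _ tendsto_const this] have "(\<lambda>n. BC_norm (\<lambda>A X. over_V0 ?h A X - over_V0 (?hs n) A X)) \<longlonglongrightarrow> 0"
    by (simp add: le)
  then show ?thesis
    by (intro CC_I[of _ ?hs]) (simp_all add: f fs over_V0_scale tr_products_scale trCtr_scale trBCtr_scale CC_D)
qed

section \<open>Matrix algebras\<close>

lemma elems_matrix_alg: "a \<in> elems (matrix_alg N) \<longleftrightarrow> (\<forall>i j. \<not> (i < N \<and> j < N) \<longrightarrow> a i j = 0)"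
  by (simp add: matrix_alg_def)

lemma matrix_entry_0: "a \<in> elems (matrix_alg N) \<Longrightarrow> N \<le> i \<or> N \<le> j \<Longrightarrow> a i j = 0"
  unfolding elems_matrix_alg by (metis not_le)

lemma unit_matrix_alg: "unit (matrix_alg N) = (\<lambda>i j. if i = j \<and> i < N then 1 else 0)"
  by (simp add: matrix_alg_def)

lemma trc_matrix_alg: "trc (matrix_alg N) a = (\<Sum>i<N. a i i) / of_nat N"
  by (simp add: matrix_alg_def)

lemma matrix_op_bounded:
  assumes "a \<in> elems (matrix_alg N)"
  shows "bounded_op a" "op_norm a \<le> (\<Sum>i<N. \<Sum>j<N. cmod (a i j))"
proof -
  have "cmod (\<Sum>i<n. \<Sum>j<n. cnj (x i) * a i j * y j) \<le> (\<Sum>i<N. \<Sum>j<N. cmod (a i j))"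
    if x: "(\<Sum>i<n. (cmod (x i))\<^sup>2) \<le> 1" and y: "(\<Sum>i<n. (cmod (y i))\<^sup>2) \<le> 1" for n x y
  proof -
    have le1: "cmod (z i) \<le> 1" if "(\<Sum>i<n. (cmod (z i))\<^sup>2) \<le> 1" "i < n" for z :: "nat \<Rightarrow> complex" and i
    proof -
      have "(cmod (z i))\<^sup>2 \<le> (\<Sum>i<n. (cmod (z i))\<^sup>2)"
        using that(2) by (intro member_le_sum) auto
      with that(1) have "(cmod (z i))\<^sup>2 \<le> 1\<^sup>2" by simp
      then show ?thesis by (rule power2_le_imp_le) simp
    qed
    have "cmod (\<Sum>i<n. \<Sum>j<n. cnj (x i) * a i j * y j) \<le> (\<Sum>i<n. \<Sum>j<n. cmod (cnj (x i) * a i j * y j))"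
      by (intro sum_norm_le order_refl)
    also have "\<dots> \<le> (\<Sum>i<n. \<Sum>j<n. cmod (a i j))"
    proof (intro sum_mono)
      fix i j assume ij: "i \<in> {..<n}" "j \<in> {..<n}"
      have "cmod (x i) * (cmod (a i j) * cmod (y j)) \<le> 1 * (cmod (a i j) * 1)"
        using le1[OF x, of i] le1[OF y, of j] ij by (intro mult_mono) auto
      then show "cmod (cnj (x i) * a i j * y j) \<le> cmod (a i j)" by (simp add: norm_mult mult.assoc)
    qed
    also have "\<dots> = (\<Sum>i\<in>{..<n}\<inter>{..<N}. \<Sum>j\<in>{..<n}\<inter>{..<N}. cmod (a i j))"
      using matrix_entry_0[OF assms]
      by (intro sum.mono_neutral_cong_right ballI sum.neutral) (auto simp: not_less)
    also have "\<dots> \<le> (\<Sum>i<N. \<Sum>j\<in>{..<n}\<inter>{..<N}. cmod (a i j))"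
      by (intro sum_mono2) (auto simp: sum_nonneg)
    also have "\<dots> \<le> (\<Sum>i<N. \<Sum>j<N. cmod (a i j))"
      by (intro sum_mono sum_mono2) auto
    finally show ?thesis .
  qed
  note bounded_opI[OF this]
  then show "bounded_op a" "op_norm a \<le> (\<Sum>i<N. \<Sum>j<N. cmod (a i j))" by blast+
qed

lemma matrix_op_mult:
  assumes "a \<in> elems (matrix_alg N)"
  shows "(a \<cdot>\<^sub>o b) i j = (\<Sum>k<N. a i k * b k j)"
proof -
  have "(\<Sum>\<^sub>\<infinity>k. a i k * b k j) = (\<Sum>\<^sub>\<infinity>k\<in>{..<N}. a i k * b k j)"
    using matrix_entry_0[OF assms] by (intro infsum_cong_neutral) auto
  then show ?thesis by (simp add: op_mult_def)
qed

lemma matrix_elems_closed: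
  assumes "a \<in> elems (matrix_alg N)" "b \<in> elems (matrix_alg N)"
  shows "a \<cdot>\<^sub>o b \<in> elems (matrix_alg N)" "a +\<^sub>o b \<in> elems (matrix_alg N)"
    "a -\<^sub>o b \<in> elems (matrix_alg N)" "adjoint_op a \<in> elems (matrix_alg N)"
    "c *\<^sub>o a \<in> elems (matrix_alg N)"
  unfolding elems_matrix_alg using matrix_entry_0[OF assms(1)] matrix_entry_0[OF assms(2)]
  by (auto simp: matrix_op_mult[OF assms(1)] op_add_def op_diff_def adjoint_op_def op_scale_def not_less
      intro!: sum.neutral)

text \<open>This equivalence and the next one identify \<open>ops_on\<close> of the unit with the N
  by N corner.\<close>

lemma unit_mult_matrix:
  "unit (matrix_alg N) \<cdot>\<^sub>o a = a \<longleftrightarrow> (\<forall>i\<ge>N. \<forall>j. a i j = 0)"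
proof -
  have u: "unit (matrix_alg N) \<in> elems (matrix_alg N)"
    by (auto simp: unit_matrix_alg elems_matrix_alg)
  have "(\<Sum>k<N. unit (matrix_alg N) i k * a k j) = (if i < N then a i j else 0)" for i j
    by (simp add: unit_matrix_alg if_distrib[of "\<lambda>x. x * _"] conj_commute cong: if_cong)
  then have "unit (matrix_alg N) \<cdot>\<^sub>o a = (\<lambda>i j. if i < N then a i j else 0)"
    by (simp add: matrix_op_mult[OF u] fun_eq_iff)
  then show ?thesis by (auto simp: fun_eq_iff not_le)
qed

lemma mult_unit_matrix:
  "a \<cdot>\<^sub>o unit (matrix_alg N) = a \<longleftrightarrow> (\<forall>i. \<forall>j\<ge>N. a i j = 0)"
proof -
  have "(\<Sum>\<^sub>\<infinity>k. a i k * unit (matrix_alg N) k j) = (if j < N then a i j else 0)" for i j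
  proof -
    have "(\<Sum>\<^sub>\<infinity>k. a i k * unit (matrix_alg N) k j) = (\<Sum>\<^sub>\<infinity>k\<in>{j}. a i k * unit (matrix_alg N) k j)"
      by (intro infsum_cong_neutral) (auto simp: unit_matrix_alg)
    then show ?thesis by (simp add: unit_matrix_alg)
  qed
  then have "a \<cdot>\<^sub>o unit (matrix_alg N) = (\<lambda>i j. if j < N then a i j else 0)"
    by (simp add: op_mult_def fun_eq_iff)
  then show ?thesis by (auto simp: fun_eq_iff not_le)
qed

section \<open>The matrix algebra as a tracial von Neumann algebra\<close>

lemma von_neumann_algebra_matrix_alg:
  "von_neumann_algebra (unit (matrix_alg N)) (elems (matrix_alg N))"
proof -
  let ?e = "unit (matrix_alg N)" and ?E = "elems (matrix_alg N)"
  have u: "?e \<in> ?E" by (auto simp: unit_matrix_alg elems_matrix_alg)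
  have ops: "ops_on ?e = ?E"
    by (auto simp: ops_on_def unit_mult_matrix mult_unit_matrix matrix_op_bounded(1) elems_matrix_alg
        simp flip: not_le)
  have "is_projection ?e"
    using matrix_op_bounded(1)[OF u]
    by (auto simp: is_projection_def unit_mult_matrix) (auto simp: unit_matrix_alg adjoint_op_def fun_eq_iff)
  \<comment> \<open>No commutant is computed: the bicommutant trivially contains the algebra and
    lies in \<open>ops_on\<close>, which is the algebra itself.\<close>
  moreover have "commutant ?e (commutant ?e ?E) = ?E"
    by (auto simp: commutant_def ops)
  moreover have "adjoint_op a \<in> ?E" if "a \<in> ?E" for a
    using that by (rule matrix_elems_closed(4)) fact
  ultimately show ?thesis by (simp add: von_neumann_algebra_def ops)
qed

lemma trc_adjoint_mult_matrix:
  assumes "x \<in> elems (matrix_alg N)"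
  shows "trc (matrix_alg N) (adjoint_op x \<cdot>\<^sub>o x) = of_real ((\<Sum>i<N. \<Sum>k<N. (cmod (x k i))\<^sup>2) / N)"
  unfolding trc_matrix_alg matrix_op_mult[OF matrix_elems_closed(4)[OF assms assms]]
  by (simp add: adjoint_op_def complex_norm_square mult.commute del: of_real_power)

text \<open>N > 0 enters through the unit: for N = 0 division by zero gives it trace 0.\<close>

lemma tracial_state_matrix_alg:
  assumes "N > 0"
  shows "tracial_state (matrix_alg N)"
  unfolding tracial_state_def
proof (intro conjI ballI allI)
  let ?E = "elems (matrix_alg N)"
  fix x y c assume xy: "x \<in> ?E" "y \<in> ?E"
  show "trc (matrix_alg N) (x +\<^sub>o y) = trc (matrix_alg N) x + trc (matrix_alg N) y"
    by (simp add: trc_matrix_alg op_add_def sum.distrib add_divide_distrib)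
  have "(\<Sum>i<N. \<Sum>k<N. x i k * y k i) = (\<Sum>i<N. \<Sum>k<N. y i k * x k i)"
    by (subst sum.swap) (simp add: mult.commute)
  then show "trc (matrix_alg N) (x \<cdot>\<^sub>o y) = trc (matrix_alg N) (y \<cdot>\<^sub>o x)"
    by (simp add: trc_matrix_alg matrix_op_mult[OF xy(1)] matrix_op_mult[OF xy(2)])
next
  fix c x
  show "trc (matrix_alg N) (c *\<^sub>o x) = c * trc (matrix_alg N) x"
    by (simp add: trc_matrix_alg op_scale_def sum_distrib_left)
next
  fix x assume "x \<in> elems (matrix_alg N)"
  then show "trc (matrix_alg N) (adjoint_op x \<cdot>\<^sub>o x) \<in> \<real>\<^sub>\<ge>\<^sub>0"
    by (simp only: trc_adjoint_mult_matrix nonneg_Reals_of_real_iff) (simp add: sum_nonneg)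
next
  show "trc (matrix_alg N) (unit (matrix_alg N)) = 1"
    using assms by (simp add: trc_matrix_alg unit_matrix_alg)
qed

lemma faithful_trace_matrix_alg:
  assumes "N > 0"
  shows "faithful_trace (matrix_alg N)"
  unfolding faithful_trace_def
proof (intro ballI impI)
  fix x assume x: "x \<in> elems (matrix_alg N)" and "trc (matrix_alg N) (adjoint_op x \<cdot>\<^sub>o x) = 0"
  then have "(\<Sum>i<N. \<Sum>k<N. (cmod (x k i))\<^sup>2) = 0"
    using assms by (simp add: trc_adjoint_mult_matrix del: of_real_sum of_real_power)
  then have "x k i = 0" if "i < N" "k < N" for i k
    using that by (subst (asm) sum_nonneg_eq_0_iff) (auto simp: sum_nonneg sum_nonneg_eq_0_iff)
  then show "x = op_zero"
    using matrix_entry_0[OF x] by (auto simp: op_zero_def fun_eq_iff) (metis not_le)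
qed

text \<open>The trace of \<open>adjoint_op z \<cdot>\<^sub>o z\<close> is the square sum of all
  entries of z divided by N, so a small gap of traces forces z to be small entrywise. This is how
  the order is controlled in the proof that the trace is normal.\<close>

lemma op_le_matrix_alg:
  assumes "op_le (matrix_alg N) x y"
  obtains z where "z \<in> elems (matrix_alg N)"
    "\<And>i j. y i j - x i j = (\<Sum>k<N. cnj (z k i) * z k j)"
    "\<And>k i. (cmod (z k i))\<^sup>2 \<le> N * (Re (trc (matrix_alg N) y) - Re (trc (matrix_alg N) x))"
proof -
  obtain z where z: "z \<in> elems (matrix_alg N)" and *: "y -\<^sub>o x = adjoint_op z \<cdot>\<^sub>o z"
    using assms by (auto simp: op_le_def)
  then have eq: "y i j - x i j = (\<Sum>k<N. cnj (z k i) * z k j)" for i j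
  proof -
    have "(y -\<^sub>o x) i j = (adjoint_op z \<cdot>\<^sub>o z) i j" by (simp only: *)
    also have "\<dots> = (\<Sum>k<N. cnj (z k i) * z k j)"
      unfolding matrix_op_mult[OF matrix_elems_closed(4)[OF z z]] by (simp add: adjoint_op_def)
    finally show ?thesis by (simp add: op_diff_def)
  qed
  have "(cmod (z k i))\<^sup>2 \<le> N * (Re (trc (matrix_alg N) y) - Re (trc (matrix_alg N) x))" for k i
  proof -
    let ?S = "\<Sum>i<N. \<Sum>k<N. (cmod (z k i))\<^sup>2"
    have "Re (y i i) - Re (x i i) = (\<Sum>k<N. (cmod (z k i))\<^sup>2)" for i
    proof -
      have "Re (y i i) - Re (x i i) = Re (\<Sum>k<N. cnj (z k i) * z k i)"
        by (simp flip: eq)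
      then show ?thesis by (simp add: cmod_power2 flip: power2_eq_square)
    qed
    then have S: "N * (Re (trc (matrix_alg N) y) - Re (trc (matrix_alg N) x)) = ?S"
      by (cases "N = 0") (simp_all add: trc_matrix_alg right_diff_distrib flip: sum_subtractf)
    show ?thesis
    proof (cases "k < N \<and> i < N")
      case True
      then have "(cmod (z k i))\<^sup>2 \<le> (\<Sum>k<N. (cmod (z k i))\<^sup>2)" by (intro member_le_sum) auto
      also have "\<dots> \<le> ?S" using True by (intro member_le_sum) (auto simp: sum_nonneg)
      finally show ?thesis using S by simp
    next
      case False
      then have "z k i = 0" using matrix_entry_0[OF z] by (auto simp: not_less)
      then show ?thesis unfolding S by (simp add: sum_nonneg)
    qed
  qed
  with z eq show ?thesis by (rule that)
qed

text \<open>Each of the N summands of the entry is a product of two entries of z, both of modulus at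
  most the square root of N times the gap of traces.\<close>

lemma op_le_matrix_entry:
  assumes "op_le (matrix_alg N) x y"
  shows "cmod (y i j - x i j) \<le> N * (N * (Re (trc (matrix_alg N) y) - Re (trc (matrix_alg N) x)))"
proof -
  obtain z where z: "\<And>i j. y i j - x i j = (\<Sum>k<N. cnj (z k i) * z k j)"
    "\<And>k i. (cmod (z k i))\<^sup>2 \<le> N * (Re (trc (matrix_alg N) y) - Re (trc (matrix_alg N) x))"
    by (rule op_le_matrix_alg[OF assms]) blast
  let ?t = "N * (Re (trc (matrix_alg N) y) - Re (trc (matrix_alg N) x))"
  have "cmod (cnj (z k i) * z k j) \<le> ?t" for k
  proof -
    have t: "0 \<le> ?t" using z(2)[of 0 0] by (meson order_trans zero_le_power2)
    have "cmod (z k i) * cmod (z k j) \<le> sqrt ?t * sqrt ?t"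
      using z(2) t by (intro mult_mono real_le_rsqrt) auto
    with t show ?thesis by (simp add: norm_mult)
  qed
  then have "cmod (\<Sum>k<N. cnj (z k i) * z k j) \<le> (\<Sum>k<N. ?t)" by (intro sum_norm_le)
  then show ?thesis by (simp add: z(1))
qed

lemma op_le_matrix_trc:
  assumes "op_le (matrix_alg N) x y"
  shows "Re (trc (matrix_alg N) x) \<le> Re (trc (matrix_alg N) y)"
proof (cases "N = 0")
  case True
  then show ?thesis by (simp add: trc_matrix_alg)
next
  case False
  obtain z where "(cmod (z 0 0))\<^sup>2 \<le> N * (Re (trc (matrix_alg N) y) - Re (trc (matrix_alg N) x))"
    by (rule op_le_matrix_alg[OF assms]) blast
  then have "0 \<le> N * (Re (trc (matrix_alg N) y) - Re (trc (matrix_alg N) x))"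
    by (meson order_trans zero_le_power2)
  then show ?thesis using False by (simp add: zero_le_mult_iff)
qed

text \<open>Matrices are infinite arrays here, so the compactness is that of a countable product of
  discs; vanishing outside the corner survives entrywise limits.\<close>

lemma bounded_matrices_convergent_subseq:
  fixes z :: "nat \<Rightarrow> mat_op"
  assumes z: "\<And>n. z n \<in> elems (matrix_alg N)" and C: "\<And>n i j. cmod (z n i j) \<le> C"
  obtains l r where "strict_mono (r :: nat \<Rightarrow> nat)" "l \<in> elems (matrix_alg N)"
    "\<And>i j. (\<lambda>n. z (r n) i j) \<longlonglongrightarrow> l i j"
proof -
  have PiE: "compact (PiE UNIV S)" if "\<And>i. compact (S i)" for S :: "nat \<Rightarrow> 'b::topological_space set"
    using compactin_PiE[of "\<lambda>_. euclidean" UNIV S] that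
    by (simp add: euclidean_product_topology)
  have "compact (PiE UNIV (\<lambda>i::nat. PiE UNIV (\<lambda>j::nat. cball (0::complex) C)))"
    by (intro PiE compact_cball)
  then have "seq_compact (PiE UNIV (\<lambda>i::nat. PiE UNIV (\<lambda>j::nat. cball (0::complex) C)))"
    by (rule compact_imp_seq_compact)
  then obtain l r where r: "strict_mono (r :: nat \<Rightarrow> nat)" "(z \<circ> r) \<longlonglongrightarrow> l"
    using C by (auto simp: PiE_def extensional_def elim!: seq_compactE[where f = z])
  have lim: "(\<lambda>n. z (r n) i j) \<longlonglongrightarrow> l i j" for i j
  proof -
    have coord: "(\<lambda>n. f n i) \<longlonglongrightarrow> l i" if "f \<longlonglongrightarrow> l" for f :: "nat \<Rightarrow> nat \<Rightarrow> 'c::topological_space" and l i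
      using continuous_on_tendsto_compose[OF continuous_on_product_coordinates[of i] that] by simp
    show ?thesis using coord[OF coord[OF r(2), of i], of j] by simp
  qed
  have "l i j = 0" if "\<not> (i < N \<and> j < N)" for i j
  proof -
    have "(\<lambda>n. z (r n) i j) \<longlonglongrightarrow> 0"
      using z that by (simp add: elems_matrix_alg)
    with lim show ?thesis by (rule LIMSEQ_unique)
  qed
  then have "l \<in> elems (matrix_alg N)" by (simp add: elems_matrix_alg)
  with r(1) show ?thesis using lim by (rule that)
qed

text \<open>Extracting a convergent subsequence of the factors \<open>z\<close> in \<open>y - x = z\<^sup>* z\<close> avoids square roots of
  positive matrices.\<close>

lemma op_le_matrix_closed:
  assumes le: "\<And>n. op_le (matrix_alg N) (x n) (y n)"
    and x: "\<And>i j. (\<lambda>n. x n i j) \<longlonglongrightarrow> a i j" and y: "\<And>i j. (\<lambda>n. y n i j) \<longlonglongrightarrow> b i j"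
  shows "op_le (matrix_alg N) a b"
proof -
  let ?t = "\<lambda>a. Re (trc (matrix_alg N) a)"
  have "\<forall>n. \<exists>z. z \<in> elems (matrix_alg N) \<and> (\<forall>i j. y n i j - x n i j = (\<Sum>k<N. cnj (z k i) * z k j))
    \<and> (\<forall>k i. (cmod (z k i))\<^sup>2 \<le> N * (?t (y n) - ?t (x n)))"
  proof
    fix n
    show "\<exists>z. z \<in> elems (matrix_alg N) \<and> (\<forall>i j. y n i j - x n i j = (\<Sum>k<N. cnj (z k i) * z k j))
      \<and> (\<forall>k i. (cmod (z k i))\<^sup>2 \<le> N * (?t (y n) - ?t (x n)))"
      by (rule op_le_matrix_alg[OF le[of n]]) blast
  qed
  from choice[OF this] obtain z where *: "\<forall>n. z n \<in> elems (matrix_alg N) \<and>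
    (\<forall>i j. y n i j - x n i j = (\<Sum>k<N. cnj (z n k i) * z n k j)) \<and>
    (\<forall>k i. (cmod (z n k i))\<^sup>2 \<le> N * (?t (y n) - ?t (x n)))"
    by (elim exE)
  then have z: "z n \<in> elems (matrix_alg N)"
    "y n i j - x n i j = (\<Sum>k<N. cnj (z n k i) * z n k j)"
    "(cmod (z n k i))\<^sup>2 \<le> N * (?t (y n) - ?t (x n))" for n i j k
    by simp_all
  have "(\<lambda>n. N * (?t (y n) - ?t (x n))) \<longlonglongrightarrow> N * (?t b - ?t a)"
    unfolding trc_matrix_alg by (cases "N = 0") (auto intro!: tendsto_intros x y)
  then have "Bseq (\<lambda>n. N * (?t (y n) - ?t (x n)))"
    by (intro convergent_imp_Bseq convergentI)
  then obtain B where B: "\<And>n. norm (N * (?t (y n) - ?t (x n))) \<le> B"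
    by (auto simp: Bseq_def)
  have sqrtB: "cmod (z n k i) \<le> sqrt B" for n k i
    by (rule real_le_rsqrt) (use z(3)[of n k i] B[of n] in \<open>simp add: abs_le_iff\<close>)
  obtain l r where l: "strict_mono (r :: nat \<Rightarrow> nat)" "l \<in> elems (matrix_alg N)"
    "\<And>i j. (\<lambda>n. z (r n) i j) \<longlonglongrightarrow> l i j"
    by (rule bounded_matrices_convergent_subseq[of z N "sqrt B", OF z(1) sqrtB]) blast
  have "b i j - a i j = (\<Sum>k<N. cnj (l k i) * l k j)" for i j
  proof (rule LIMSEQ_unique)
    show "(\<lambda>n. y (r n) i j - x (r n) i j) \<longlonglongrightarrow> b i j - a i j"
      using LIMSEQ_subseq_LIMSEQ[OF x l(1)] LIMSEQ_subseq_LIMSEQ[OF y l(1)]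
      by (intro tendsto_diff) (simp_all add: comp_def)
    show "(\<lambda>n. y (r n) i j - x (r n) i j) \<longlonglongrightarrow> (\<Sum>k<N. cnj (l k i) * l k j)"
      unfolding z(2) by (intro tendsto_intros l(3))
  qed
  then have "b -\<^sub>o a = adjoint_op l \<cdot>\<^sub>o l"
    by (simp add: op_diff_def matrix_op_mult[OF matrix_elems_closed(4)[OF l(2) l(2)]] fun_eq_iff)
      (simp add: adjoint_op_def)
  with l(2) show ?thesis by (auto simp: op_le_def)
qed

text \<open>A sequence \<open>x\<^sub>n\<close> in \<open>D\<close> whose traces approach the supremum subconverges to some \<open>l\<close>. If \<open>z\<^sub>n \<in> D\<close>
  dominates both \<open>x\<^sub>n\<close> and \<open>y\<close>, then \<open>z\<^sub>n - x\<^sub>n\<close> is positive with trace tending to 0, so \<open>z\<^sub>n\<close> tends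
  to \<open>l\<close> and \<open>y \<le> l\<close>; hence \<open>s \<le> l\<close>.\<close>

lemma normal_trace_matrix_alg: "normal_trace (matrix_alg N)"
  unfolding normal_trace_def
proof (intro allI impI, elim conjE)
  fix D s
  let ?t = "\<lambda>a. Re (trc (matrix_alg N) a)" and ?le = "op_le (matrix_alg N)"
  assume D: "D \<noteq> {}" "D \<subseteq> sa (matrix_alg N)" and dir: "\<forall>x\<in>D. \<forall>y\<in>D. \<exists>z\<in>D. ?le x z \<and> ?le y z"
    and s: "s \<in> sa (matrix_alg N)" and ub: "\<forall>x\<in>D. ?le x s"
    and lub: "\<forall>t\<in>sa (matrix_alg N). (\<forall>x\<in>D. ?le x t) \<longrightarrow> ?le s t"
  define m where "m = (SUP x\<in>D. ?t x)"
  have bdd: "bdd_above (?t ` D)"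
    using ub op_le_matrix_trc by (intro bdd_aboveI2[of _ _ "?t s"]) auto
  have m: "?t x \<le> m" if "x \<in> D" for x
    unfolding m_def using that bdd by (rule cSUP_upper)
  have "m \<le> ?t s" unfolding m_def using D ub op_le_matrix_trc by (intro cSUP_least) auto
  moreover have "?t s \<le> m"
  proof -
    have "\<exists>x\<in>D. m - inverse (real (Suc n)) < ?t x" for n
    proof -
      have "m - inverse (real (Suc n)) < m" by simp
      then show ?thesis unfolding m_def by (subst (asm) less_cSUP_iff[OF D(1) bdd]) simp
    qed
    then obtain x where x: "\<And>n. x n \<in> D" "\<And>n. m - inverse (real (Suc n)) < ?t (x n)" by metis
    have elems: "a \<in> elems (matrix_alg N)" if "a \<in> D" for a using that D by (auto simp: sa_def)
    \<comment> \<open>The common bound comes from s: the positive matrix s - x n has trace less than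
      \<open>?t s - m + 1\<close>.\<close>
    have "cmod (x n i j) \<le> op_norm s + N * (N * (?t s - m + 1))" for n i j
    proof -
      have "cmod (x n i j) \<le> cmod (s i j) + cmod (s i j - x n i j)"
        using norm_triangle_ineq4[of "s i j" "s i j - x n i j"] by simp
      also have "\<dots> \<le> op_norm s + N * (N * (?t s - ?t (x n)))"
        using s ub x(1) by (intro add_mono norm_entry_le_op_norm op_le_matrix_entry)
          (auto simp: sa_def matrix_op_bounded)
      also have "\<dots> \<le> op_norm s + N * (N * (?t s - m + 1))"
      proof -
        have "inverse (real (Suc n)) \<le> 1" by (simp add: inverse_le_1_iff)
        with x(2)[of n] show ?thesis by (intro add_left_mono mult_left_mono) auto
      qed
      finally show ?thesis .
    qed
    then obtain l r where r: "strict_mono (r :: nat \<Rightarrow> nat)" and l: "l \<in> elems (matrix_alg N)"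
      and lim: "\<And>i j. (\<lambda>n. x (r n) i j) \<longlonglongrightarrow> l i j"
      using bounded_matrices_convergent_subseq[of x N] elems x(1) by metis
    have "adjoint_op l i j = l i j" for i j
    proof (rule LIMSEQ_unique)
      have "adjoint_op (x n) i j = x n i j" for n
        using x(1)[of n] D by (auto simp: sa_def)
      then show "(\<lambda>n. x (r n) i j) \<longlonglongrightarrow> adjoint_op l i j"
        using tendsto_cnj[OF lim[of j i]] by (simp add: adjoint_op_def)
    qed (rule lim)
    with l have "l \<in> sa (matrix_alg N)" by (auto simp: sa_def fun_eq_iff)
    moreover have "?le y l" if y: "y \<in> D" for y
    proof -
      have "\<exists>z\<in>D. ?le y z \<and> ?le (x (r n)) z" for n using dir y x(1) by blast
      then obtain z where z: "\<And>n. z n \<in> D" "\<And>n. ?le y (z n)" "\<And>n. ?le (x (r n)) (z n)" by metis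
      have zl: "(\<lambda>n. z n i j) \<longlonglongrightarrow> l i j" for i j
      proof -
        have le: "cmod (z n i j - x (r n) i j) \<le> N * (N * inverse (real (Suc n)))" for n
        proof -
          have "?t (z n) - ?t (x (r n)) \<le> inverse (real (Suc (r n)))"
            using m[OF z(1)[of n]] x(2)[of "r n"] by simp
          also have "\<dots> \<le> inverse (real (Suc n))"
            using seq_suble[OF r, of n] by (intro le_imp_inverse_le) auto
          finally have "N * (N * (?t (z n) - ?t (x (r n)))) \<le> N * (N * inverse (real (Suc n)))"
            by (intro mult_left_mono) auto
          with op_le_matrix_entry[OF z(3)[of n], of i j] show ?thesis by simp
        qed
        have "(\<lambda>n. N * (N * inverse (real (Suc n)))) \<longlonglongrightarrow> real N * (real N * 0)"
          by (intro tendsto_intros LIMSEQ_inverse_real_of_nat)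
        then have "(\<lambda>n. N * (N * inverse (real (Suc n)))) \<longlonglongrightarrow> 0" by simp
        then have "(\<lambda>n. z n i j - x (r n) i j) \<longlonglongrightarrow> 0"
          by (rule Lim_null_comparison[OF always_eventually[OF allI[OF le]]])
        from tendsto_add[OF this lim[of i j]] show ?thesis by simp
      qed
      show ?thesis by (rule op_le_matrix_closed[OF z(2) tendsto_const zl])
    qed
    ultimately have "?t s \<le> ?t l" using lub by (intro op_le_matrix_trc) auto
    also have "?t l \<le> m"
    proof (rule LIMSEQ_le_const2)
      show "(\<lambda>n. ?t (x (r n))) \<longlonglongrightarrow> ?t l"
        unfolding trc_matrix_alg by (cases "N = 0") (auto intro!: tendsto_intros lim)
      show "\<exists>n0. \<forall>n\<ge>n0. ?t (x (r n)) \<le> m" using m x(1) by auto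
    qed
    finally show ?thesis .
  qed
  ultimately show "?t s = (SUP x\<in>D. ?t x)" by (simp add: m_def)
qed

lemma matrix_alg_in_WW: "N > 0 \<Longrightarrow> matrix_alg N \<in> WW"
  by (simp add: WW_def von_neumann_algebra_matrix_alg tracial_state_matrix_alg
      faithful_trace_matrix_alg normal_trace_matrix_alg)

section \<open>Test functions on matrices\<close>

lemma continuous_on_sum_list:
  fixes f :: "'t \<Rightarrow> 'a::topological_space \<Rightarrow> 'b::topological_monoid_add"
  assumes "\<And>t. t \<in> set ts \<Longrightarrow> continuous_on S (f t)"
  shows "continuous_on S (\<lambda>x. \<Sum>t\<leftarrow>ts. f t x)"
  using assms by (induction ts) (auto intro!: continuous_intros)

lemma continuous_on_prod_list:
  fixes f :: "'t \<Rightarrow> 'a::topological_space \<Rightarrow> 'b::real_normed_algebra_1"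
  assumes "\<And>t. t \<in> set ts \<Longrightarrow> continuous_on S (f t)"
  shows "continuous_on S (\<lambda>x. \<Prod>t\<leftarrow>ts. f t x)"
  using assms by (induction ts) (auto intro!: continuous_intros)

lemma continuous_on_matrix_entry: "continuous_on S (\<lambda>X. X k i j)"
  for S :: "('d \<Rightarrow> 'i \<Rightarrow> 'j \<Rightarrow> 'a::topological_space) set"
  by (rule continuous_on_product_then_coordinatewise[OF
        continuous_on_product_then_coordinatewise[OF
        continuous_on_product_then_coordinatewise[OF continuous_on_id]]])

lemma sa_tuples_elems: "X \<in> sa_tuples A \<Longrightarrow> X k \<in> elems A"
  by (simp add: sa_tuples_def sa_def)

text \<open>On tuples supported in the corner all products are finite sums, so the values are
  polynomials in the matrix entries. On arbitrary infinite matrices the product need not be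
  continuous, hence the restriction to self-adjoint tuples.\<close>

lemma continuous_on_tp_eval:
  "continuous_on (sa_tuples (matrix_alg N)) (\<lambda>X. tp_eval q (matrix_alg N) X i j)"
proof -
  let ?M = "matrix_alg N" and ?S = "sa_tuples (matrix_alg N) :: ('a \<Rightarrow> mat_op) set"
  have w: "continuous_on ?S (\<lambda>X. word_eval ?M X w i j)" for w i j
  proof (induction w arbitrary: i j)
    case Nil
    then show ?case by (simp add: word_eval_def)
  next
    case (Cons v w)
    have "continuous_on ?S (\<lambda>X. \<Sum>k<N. X v i k * word_eval ?M X w k j)"
      by (intro continuous_intros continuous_on_matrix_entry Cons)
    then show ?case
      by (rule continuous_on_eq) (simp add: word_eval_def matrix_op_mult[OF sa_tuples_elems])
  qed
  have nc: "continuous_on ?S (\<lambda>X. nc_eval ?M X p i j)" for p i j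
    unfolding nc_eval_def case_prod_beta'
    by (intro continuous_on_sum_list continuous_intros w)
  have "continuous_on ?S (\<lambda>X. trc ?M (nc_eval ?M X p))" for p
  proof (cases "N = 0")
    case False
    then show ?thesis unfolding trc_matrix_alg by (intro continuous_intros nc) simp
  qed (simp add: trc_matrix_alg)
  then show ?thesis
    unfolding tp_eval_def case_prod_beta'
    by (intro continuous_on_sum_list continuous_on_prod_list continuous_intros nc)
qed

lemma sup_norm_le_iff: "sup_norm X \<le> R \<longleftrightarrow> (\<forall>k. op_norm (X k) \<le> R)"
  by (auto simp: sup_norm_def)

text \<open>A scalar is compared with an operator-valued trace polynomial through the entry (0, 0),
  where the unit equals 1 because N > 0.\<close>

lemma norm_scalar_le_op_norm:
  assumes "N > 0" "X \<in> sa_tuples (matrix_alg N)"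
  shows "cmod (c - tp_eval q (matrix_alg N) X 0 0) \<le> op_norm (c *\<^sub>o unit (matrix_alg N) -\<^sub>o tp_eval q (matrix_alg N) X)"
proof -
  let ?M = "matrix_alg N"
  have "bounded_op (c *\<^sub>o unit ?M -\<^sub>o tp_eval q ?M X)"
    using matrix_alg_in_WW[OF assms(1)] assms(2)
    by (intro op_diff_bounded op_scale_bounded WW_unit tp_eval_bounded)
  from norm_entry_le_op_norm[OF this, of 0 0] show ?thesis
    using assms by (simp add: op_diff_def op_scale_def unit_matrix_alg)
qed

text \<open>A locally uniform limit of continuous functions is continuous.\<close>

lemma trCtr_matrix_continuous:
  fixes f :: "('d::finite) scalar_family"
  assumes f: "f \<in> trCtr" and N: "N > 0"
  shows "continuous_on (sa_tuples (matrix_alg N)) (f (matrix_alg N))"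
  unfolding continuous_on_def
proof
  let ?M = "matrix_alg N" and ?S = "sa_tuples (matrix_alg N) :: ('d \<Rightarrow> mat_op) set"
  fix X0 assume X0: "X0 \<in> ?S"
  \<comment> \<open>An entrywise majorant of \<open>sup_norm\<close> that is evidently continuous.
    With R = b X0 + 1, the set where b < R is a neighborhood of X0 on which the approximation is
    uniform.\<close>
  define b where "b = (\<lambda>X :: 'd \<Rightarrow> mat_op. \<Sum>k\<in>UNIV. \<Sum>i<N. \<Sum>j<N. cmod (X k i j))"
  define R where "R = b X0 + 1"
  have R: "R > 0" unfolding R_def b_def by (intro add_nonneg_pos sum_nonneg) auto
  have sup: "sup_norm X \<le> b X" if "X \<in> ?S" for X
    unfolding sup_norm_le_iff
  proof
    fix k
    have "op_norm (X k) \<le> (\<Sum>i<N. \<Sum>j<N. cmod (X k i j))"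
      using that by (intro matrix_op_bounded sa_tuples_elems)
    also have "\<dots> \<le> b X" unfolding b_def
      by (rule member_le_sum) (auto intro!: sum_nonneg)
    finally show "op_norm (X k) \<le> b X" .
  qed
  have b: "continuous_on UNIV b"
    unfolding b_def by (intro continuous_intros continuous_on_matrix_entry)
  show "(f ?M \<longlongrightarrow> f ?M X0) (at X0 within ?S)"
  proof (rule tendstoI)
    fix e :: real assume "e > 0"
    then have e3: "e / 3 > 0" by simp
    obtain q where q: "Ctr_norm R (\<lambda>A X. as_op_family f A X -\<^sub>o tp_eval q A X) < ennreal (e/3)"
      using trCtr_approx[OF f R e3] .
    have close: "cmod (f ?M X - tp_eval q ?M X 0 0) < e / 3" if X: "X \<in> ?S" "b X \<le> R" for X
    proof -
      have "cmod (f ?M X - tp_eval q ?M X 0 0) \<le> op_norm (as_op_family f ?M X -\<^sub>o tp_eval q ?M X)"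
        unfolding as_op_family_def using N X(1) by (rule norm_scalar_le_op_norm)
      then have "ennreal (cmod (f ?M X - tp_eval q ?M X 0 0)) \<le>
          ennreal (op_norm (as_op_family f ?M X -\<^sub>o tp_eval q ?M X))"
        by (rule ennreal_leI)
      also have "\<dots> \<le> Ctr_norm R (\<lambda>A X. as_op_family f A X -\<^sub>o tp_eval q A X)"
        using matrix_alg_in_WW[OF N] X sup[OF X(1)]
        by (intro Ctr_norm_le_iff[THEN iffD1, OF order_refl, rule_format]) auto
      also have "\<dots> < ennreal (e/3)" by (rule q)
      finally show ?thesis by (simp add: ennreal_less_iff)
    qed
    have "((\<lambda>X. tp_eval q ?M X 0 0) \<longlongrightarrow> tp_eval q ?M X0 0 0) (at X0 within ?S)"
      using continuous_on_tp_eval X0 unfolding continuous_on_def by blast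
    from tendstoD[OF this e3]
    have "\<forall>\<^sub>F X in at X0 within ?S. dist (tp_eval q ?M X 0 0) (tp_eval q ?M X0 0 0) < e / 3" .
    moreover have "\<forall>\<^sub>F X in at X0 within ?S. b X < R"
    proof -
      have "(b \<longlongrightarrow> b X0) (at X0 within ?S)"
        using continuous_on_subset[OF b, of ?S] X0 unfolding continuous_on_def by blast
      then show ?thesis by (rule order_tendstoD) (simp add: R_def)
    qed
    moreover have "\<forall>\<^sub>F X in at X0 within ?S. X \<in> ?S" by (simp add: eventually_at_filter)
    ultimately show "\<forall>\<^sub>F X in at X0 within ?S. dist (f ?M X) (f ?M X0) < e"
    proof eventually_elim
      case (elim X)
      have "dist (f ?M X) (f ?M X0) \<le> cmod (f ?M X - tp_eval q ?M X 0 0) +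
        dist (tp_eval q ?M X 0 0) (tp_eval q ?M X0 0 0) + cmod (f ?M X0 - tp_eval q ?M X0 0 0)"
        unfolding dist_norm by norm
      also have "\<dots> < e / 3 + e / 3 + e / 3"
        using elim close[of X] close[OF X0] by (intro add_strict_mono) (auto simp: R_def)
      finally show ?case by simp
    qed
  qed
qed

lemma V0_matrix:
  assumes "X \<in> sa_tuples (matrix_alg N)"
  shows "V0 (matrix_alg N) X = (\<Sum>k\<in>UNIV. \<Sum>i<N. \<Sum>j<N. (cmod (X k i j))\<^sup>2) / (2 * N)"
proof -
  have "Re (trc (matrix_alg N) (adjoint_op (X k) \<cdot>\<^sub>o X k)) = (\<Sum>i<N. \<Sum>j<N. (cmod (X k i j))\<^sup>2) / N" for k
    unfolding trc_adjoint_mult_matrix[OF sa_tuples_elems[OF assms]] Re_complex_of_real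
    by (subst sum.swap) simp
  then show ?thesis by (simp add: V0_def flip: sum_divide_distrib)
qed

lemma V0_matrix_nonneg: "X \<in> sa_tuples (matrix_alg N) \<Longrightarrow> 0 \<le> V0 (matrix_alg N) X"
  by (simp add: V0_matrix sum_nonneg)

lemma closed_sa_tuples_matrix: "closed (sa_tuples (matrix_alg N) :: ('d::finite \<Rightarrow> mat_op) set)"
proof -
  \<comment> \<open>Vanishing outside the corner is written as an equation with a factor 0 or 1, so
    that closedness follows from continuity of both sides.\<close>
  have eq: "(sa_tuples (matrix_alg N) :: ('d \<Rightarrow> mat_op) set) =
    {X. \<forall>k i j. (if i < N \<and> j < N then 0 else 1) * X k i j = 0 \<and> cnj (X k j i) = X k i j}"
    by (auto simp: sa_tuples_def sa_def elems_matrix_alg adjoint_op_def fun_eq_iff)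
  show ?thesis unfolding eq
    by (intro closed_Collect_all closed_Collect_conj closed_Collect_eq continuous_intros
        continuous_on_matrix_entry)
qed

text \<open>Functions in \<open>trCtr\<close> vanish off the closed set of self-adjoint tuples, so
  continuity on that set gives measurability on the space of all tuples of infinite
  matrices.\<close>

lemma trCtr_matrix_measurable:
  assumes f: "f \<in> trCtr" and N: "N > 0"
  shows "f (matrix_alg N) \<in> borel_measurable borel"
proof -
  have "(\<lambda>X. if X \<in> sa_tuples (matrix_alg N) then f (matrix_alg N) X else 0) \<in> borel_measurable borel"
    by (intro borel_measurable_continuous_on_if trCtr_matrix_continuous f N continuous_on_const
        borel_closed closed_sa_tuples_matrix)
  also have "(\<lambda>X. if X \<in> sa_tuples (matrix_alg N) then f (matrix_alg N) X else 0) = restrict_fam f (matrix_alg N)"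
    using matrix_alg_in_WW[OF N] by (auto simp: restrict_fam_def)
  finally show ?thesis using trCtr_restrict[OF f] by simp
qed

text \<open>The bridge from \<open>CC_norm\<close> to pointwise values. It yields both V \<le> C (1
  + V0) for the potential and the norm bound 1 + V0(X) for the law of X.\<close>

lemma CC_bound:
  fixes f :: "('d::finite) scalar_family"
  assumes f: "f \<in> CC" and N: "N > 0" and X: "X \<in> sa_tuples (matrix_alg N)"
  shows "cmod (f (matrix_alg N) X) \<le> CC_norm f * (1 + V0 (matrix_alg N) X)"
proof -
  let ?M = "matrix_alg N"
  \<comment> \<open>The supremum in \<open>BC_norm\<close> ranges over R > 0, hence the maximum with
    1.\<close>
  define R where "R = max 1 (sup_norm X)"
  have "ennreal (cmod (over_V0 f ?M X)) = ennreal (cmod (as_op_family (over_V0 f) ?M X 0 0))"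
    using N by (simp add: as_op_family_def op_scale_def unit_matrix_alg)
  also have "\<dots> \<le> ennreal (op_norm (as_op_family (over_V0 f) ?M X))"
    by (intro ennreal_leI norm_entry_le_op_norm as_op_family_bounded matrix_alg_in_WW N)
  also have "\<dots> \<le> Ctr_norm R (as_op_family (over_V0 f))"
    using Ctr_norm_le_iff[of R "as_op_family (over_V0 f)" "Ctr_norm R (as_op_family (over_V0 f))"]
      matrix_alg_in_WW[OF N] X by (simp add: R_def)
  also have "\<dots> \<le> BC_norm (over_V0 f)"
    unfolding BC_norm_def by (intro SUP_upper) (simp add: R_def)
  also have "\<dots> = ennreal (CC_norm f)"
    using CC_D(2)[OF f] by (simp add: CC_norm_def trBCtr_def)
  finally have "cmod (over_V0 f ?M X) \<le> CC_norm f"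
    by (simp add: ennreal_le_iff CC_norm_def)
  moreover have "cmod (of_real (1 + V0 ?M X)) = 1 + V0 ?M X" "1 + V0 ?M X > 0"
    using V0_matrix_nonneg[OF X] by (simp_all del: of_real_add)
  ultimately show ?thesis by (simp add: over_V0_def norm_divide pos_divide_le_eq del: of_real_add)
qed

lemma CC_norm_nonneg: "0 \<le> CC_norm f"
  by (simp add: CC_norm_def)

lemma law_functional_in_CC_dual:
  assumes N: "N > 0" and X: "X \<in> sa_tuples (matrix_alg N)"
  shows "law_functional (matrix_alg N) X \<in> CC_dual"
proof -
  have "cmod (f (matrix_alg N) X) \<le> (1 + V0 (matrix_alg N) X) * CC_norm f" if "f \<in> CC" for f
    using CC_bound[OF that N X] by (simp add: mult.commute)
  then show ?thesis
    unfolding CC_dual_def law_functional_def by (auto simp: CC_add CC_scale)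
qed

lemma topspace_weak_star [simp]: "topspace weak_star = CC_dual"
  by (auto simp: weak_star_def CC_dual_def PiE_def)

text \<open>The weak-\<star> topology is the initial one for evaluation at test functions, and these
  are continuous in X; the microstates are thus relatively open in a closed set.\<close>

lemma microstates_borel:
  fixes U :: "(('d::finite) scalar_family \<Rightarrow> complex) set"
  assumes U: "openin weak_star U" and N: "N > 0"
  shows "microstates N U \<in> sets borel"
proof -
  let ?M = "matrix_alg N" and ?S = "sa_tuples (matrix_alg N) :: ('d \<Rightarrow> mat_op) set"
  have "continuous_map (top_of_set ?S) weak_star (law_functional ?M)"
    unfolding weak_star_def
  proof (rule continuous_map_into_subtopology)
    have "continuous_map (top_of_set ?S) euclidean (\<lambda>X. law_functional ?M X f)" if "f \<in> CC" for f
      using trCtr_matrix_continuous[OF CC_D(1)[OF that] N] that by (simp add: law_functional_def)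
    then show "continuous_map (top_of_set ?S) (product_topology (\<lambda>_. euclidean) CC) (law_functional ?M)"
      by (auto simp: continuous_map_componentwise law_functional_def)
    show "law_functional ?M \<in> topspace (top_of_set ?S) \<rightarrow> CC_dual"
      using law_functional_in_CC_dual[OF N] by auto
  qed
  from openin_continuous_map_preimage[OF this U]
  have "openin (top_of_set ?S) (microstates N U)" by (simp add: microstates_def)
  then obtain T where "open T" "microstates N U = ?S \<inter> T" by (auto simp: openin_open)
  then show ?thesis using closed_sa_tuples_matrix[of N, THEN borel_closed] by auto
qed

section \<open>Gibbs measures\<close>

text \<open>Agrees with \<^const>\<open>V0\<close> on self-adjoint tuples of matrices, but is continuous on all tuples of
  infinite matrices, the space on which \<^const>\<open>lebesgue_sa\<close> lives.\<close>

definition matrix_V0 :: "nat \<Rightarrow> ('d::finite \<Rightarrow> mat_op) \<Rightarrow> real" where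
  "matrix_V0 N X = (\<Sum>k\<in>UNIV. \<Sum>i<N. \<Sum>j<N. (cmod (X k i j))\<^sup>2) / (2 * N)"

lemma V0_eq_matrix_V0: "X \<in> sa_tuples (matrix_alg N) \<Longrightarrow> V0 (matrix_alg N) X = matrix_V0 N X"
  unfolding matrix_V0_def by (rule V0_matrix)

lemma matrix_V0_measurable [measurable]: "matrix_V0 N \<in> borel_measurable borel"
proof (cases "N = 0")
  case False
  then have "continuous_on UNIV (matrix_V0 N :: ('d::finite \<Rightarrow> mat_op) \<Rightarrow> real)"
    unfolding matrix_V0_def by (intro continuous_intros continuous_on_matrix_entry) simp
  then show ?thesis by (rule borel_measurable_continuous_onI)
qed (simp add: matrix_V0_def[abs_def])

section \<open>Coordinates on Hermitian tuples and Gaussian integrals\<close>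

lemma hermitian_of_sa: "hermitian_of N x \<in> sa_tuples (matrix_alg N)"
  by (auto simp: sa_tuples_def sa_def elems_matrix_alg hermitian_of_def adjoint_op_def fun_eq_iff
      complex_eq_iff)

lemma hermitian_of_measurable:
  "(hermitian_of N :: _ \<Rightarrow> 'd::finite \<Rightarrow> mat_op) \<in> borel_measurable (Pi\<^sub>M (UNIV \<times> {..<N} \<times> {..<N}) (\<lambda>_. lborel))"
    (is "_ \<in> borel_measurable ?P")
proof (intro measurable_coordinatewise_then_product)
  fix k i j
  have x: "(\<lambda>x. x (k, i, j)) \<in> borel_measurable ?P" if "i < N" "j < N" for i j
    using that measurable_component_singleton[of "(k, i, j)" "UNIV \<times> {..<N} \<times> {..<N}" "\<lambda>_. lborel"]
    by simp
  show "(\<lambda>x. hermitian_of N x k i j) \<in> borel_measurable ?P"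
    unfolding hermitian_of_def Complex_eq
    by (cases "i < N \<and> j < N"; cases "i = j"; cases "i < j")
       (auto intro!: borel_measurable_add borel_measurable_times borel_measurable_const
         borel_measurable_of_real borel_measurable_uminus x)
qed

lemma space_lebesgue_sa [simp]: "space (lebesgue_sa N) = UNIV"
  and sets_lebesgue_sa [simp, measurable_cong]: "sets (lebesgue_sa N) = sets borel"
  by (simp_all add: lebesgue_sa_def)

text \<open>The image measure sits on the range of the parametrization, so bounds on V for
  self-adjoint tuples become bounds almost everywhere.\<close>

lemma AE_lebesgue_sa: "AE X in lebesgue_sa N. X \<in> sa_tuples (matrix_alg N)"
  unfolding lebesgue_sa_def
  by (subst AE_distr_iff[OF hermitian_of_measurable])
     (simp_all add: hermitian_of_sa borel_closed closed_sa_tuples_matrix)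

text \<open>Off the diagonal, the entries (i, j) and (j, i) both have squared modulus equal to the
  sum of the squares of the same two coordinates, so each coordinate counts twice.\<close>

lemma matrix_V0_hermitian_of:
  "matrix_V0 N (hermitian_of N x) =
    (\<Sum>(k, i, j)\<in>UNIV \<times> {..<N} \<times> {..<N}. (if i = j then 1 else 2) * (x (k, i, j))\<^sup>2) / (2 * N)"
proof -
  have "(\<Sum>i<N. \<Sum>j<N. (cmod (hermitian_of N x k i j))\<^sup>2) =
    (\<Sum>i<N. \<Sum>j<N. (if i = j then 1 else 2) * (x (k, i, j))\<^sup>2)" for k
  proof -
    have "(\<Sum>i<N. \<Sum>j<N. (cmod (hermitian_of N x k i j))\<^sup>2) =
      (\<Sum>i<N. \<Sum>j<N. (x (k, i, j))\<^sup>2 + (if i = j then 0 else (x (k, j, i))\<^sup>2))"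
      by (intro sum.cong) (auto simp: hermitian_of_def cmod_power2)
    also have "\<dots> = (\<Sum>i<N. \<Sum>j<N. (x (k, i, j))\<^sup>2) + (\<Sum>j<N. \<Sum>i<N. (if i = j then 0 else (x (k, j, i))\<^sup>2))"
      by (subst sum.swap[of "\<lambda>j i. if i = j then 0 else (x (k, j, i))\<^sup>2"]) (simp add: sum.distrib)
    also have "\<dots> = (\<Sum>i<N. \<Sum>j<N. (if i = j then 1 else 2) * (x (k, i, j))\<^sup>2)"
      unfolding sum.distrib[symmetric] by (intro sum.cong) auto
    finally show ?thesis .
  qed
  then show ?thesis by (simp add: matrix_V0_def sum.cartesian_product case_prod_beta')
qed

text \<open>The integrand is a multiple of the normal density of variance 1 / (2 s).\<close>

lemma nn_integral_gaussian:
  fixes s :: real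
  assumes "s > 0"
  shows "(\<integral>\<^sup>+x. ennreal (exp (- s * x\<^sup>2)) \<partial>lborel) = ennreal (sqrt (pi / s))"
proof -
  define \<sigma> where "\<sigma> = sqrt (1 / (2 * s))"
  have "\<sigma> > 0" using assms by (simp add: \<sigma>_def)
  have \<sigma>: "\<sigma>\<^sup>2 = 1 / (2 * s)" using assms by (simp add: \<sigma>_def)
  have "exp (- s * x\<^sup>2) = sqrt (pi / s) * normal_density 0 \<sigma> x" for x
    using assms by (simp add: normal_density_def \<sigma> field_simps)
  then have "(\<integral>\<^sup>+x. ennreal (exp (- s * x\<^sup>2)) \<partial>lborel) =
    (\<integral>\<^sup>+x. ennreal (sqrt (pi / s)) * ennreal (normal_density 0 \<sigma> x) \<partial>lborel)"
    using assms by (simp add: ennreal_mult)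
  also have "\<dots> = ennreal (sqrt (pi / s)) * (\<integral>\<^sup>+x. ennreal (normal_density 0 \<sigma> x) \<partial>lborel)"
    by (intro nn_integral_cmult) simp
  also have "(\<integral>\<^sup>+x. ennreal (normal_density 0 \<sigma> x) \<partial>lborel) = 1"
    using \<open>\<sigma> > 0\<close> by (subst nn_integral_eq_integral) auto
  finally show ?thesis by simp
qed

text \<open>K collects everything that does not depend on c. Only its positivity matters, since it
  cancels in the tail estimate.\<close>

lemma nn_integral_matrix_gaussian:
  assumes N: "N > 0"
  obtains K where "K > 0"
    "\<And>c. c > 0 \<Longrightarrow> (\<integral>\<^sup>+X. ennreal (exp (- (real N)\<^sup>2 * (c * matrix_V0 N X)))
      \<partial>(lebesgue_sa N :: ('d::finite \<Rightarrow> mat_op) measure)) = ennreal (K * sqrt (1 / c) ^ (CARD('d) * N\<^sup>2))"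
proof
  let ?I = "(UNIV :: 'd set) \<times> {..<N} \<times> {..<N}"
  \<comment> \<open>N^2 times \<open>matrix_V0\<close> has the prefactor N / 2, doubled off the
    diagonal.\<close>
  define w :: "'d \<times> nat \<times> nat \<Rightarrow> real" where "w = (\<lambda>(k, i, j). (if i = j then 1 else 2) * N / 2)"
  define K where "K = (\<Prod>p\<in>?I. sqrt (pi / w p))"
  have w: "w p > 0" for p using N by (auto simp: w_def split: prod.split)
  show "K > 0" unfolding K_def using w by (intro prod_pos) simp
  fix c :: real assume c: "c > 0"
  interpret product_sigma_finite "\<lambda>_ :: 'd \<times> nat \<times> nat. lborel :: real measure" ..
  have eq: "(real N)\<^sup>2 * (c * matrix_V0 N (hermitian_of N x)) = (\<Sum>p\<in>?I. c * w p * (x p)\<^sup>2)" for x :: "'d \<times> nat \<times> nat \<Rightarrow> real"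
    using N unfolding matrix_V0_hermitian_of
    by (simp add: sum_distrib_left sum_divide_distrib w_def case_prod_beta' power2_eq_square)
       (intro sum.cong refl, auto simp: field_simps)
  have "(\<integral>\<^sup>+X. ennreal (exp (- (real N)\<^sup>2 * (c * matrix_V0 N X))) \<partial>(lebesgue_sa N :: ('d \<Rightarrow> mat_op) measure)) =
    (\<integral>\<^sup>+x. ennreal (exp (- (real N)\<^sup>2 * (c * matrix_V0 N (hermitian_of N x :: 'd \<Rightarrow> mat_op)))) \<partial>Pi\<^sub>M ?I (\<lambda>_. lborel))"
    unfolding lebesgue_sa_def by (intro nn_integral_distr hermitian_of_measurable) measurable
  also have "\<dots> = (\<integral>\<^sup>+x. (\<Prod>p\<in>?I. ennreal (exp (- (c * w p) * (x p)\<^sup>2))) \<partial>Pi\<^sub>M ?I (\<lambda>_. lborel))"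
    by (simp add: eq prod_ennreal flip: exp_sum sum_negf)
  also have "\<dots> = (\<Prod>p\<in>?I. \<integral>\<^sup>+x. ennreal (exp (- (c * w p) * x\<^sup>2)) \<partial>lborel)"
    by (intro product_nn_integral_prod) auto
  also have "\<dots> = (\<Prod>p\<in>?I. ennreal (sqrt (1 / c) * sqrt (pi / w p)))"
  proof (intro prod.cong refl)
    fix p
    have "c * w p > 0" using c w by simp
    from nn_integral_gaussian[OF this]
    show "(\<integral>\<^sup>+x. ennreal (exp (- (c * w p) * x\<^sup>2)) \<partial>lborel) = ennreal (sqrt (1 / c) * sqrt (pi / w p))"
      by (simp add: real_sqrt_divide real_sqrt_mult)
  qed
  also have "\<dots> = ennreal (K * sqrt (1 / c) ^ (CARD('d) * N\<^sup>2))"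
    using c w by (subst prod_ennreal)
      (auto simp: prod.distrib K_def card_cartesian_product power2_eq_square less_imp_le mult.commute)
  finally show "(\<integral>\<^sup>+X. ennreal (exp (- (real N)\<^sup>2 * (c * matrix_V0 N X)))
    \<partial>(lebesgue_sa N :: ('d \<Rightarrow> mat_op) measure)) = ennreal (K * sqrt (1 / c) ^ (CARD('d) * N\<^sup>2))" .
qed

lemma nn_integral_exp_affine:
  assumes f [measurable]: "f \<in> borel_measurable M"
  shows "(\<integral>\<^sup>+X. ennreal (exp (u + f X)) \<partial>M) = ennreal (exp u) * (\<integral>\<^sup>+X. ennreal (exp (f X)) \<partial>M)"
  by (subst nn_integral_cmult[symmetric]) (auto simp: exp_add ennreal_mult)

section \<open>Normalization and tails of the Gibbs measure\<close>

definition partition_function :: "('d::finite) scalar_family \<Rightarrow> nat \<Rightarrow> ennreal" where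
  "partition_function V N = (\<integral>\<^sup>+Y. gibbs_weight V N Y \<partial>lebesgue_sa N)"

lemma gibbs_weight_measurable:
  assumes "V \<in> CC" "N > 0"
  shows "gibbs_weight V N \<in> borel_measurable borel"
proof -
  note [measurable] = trCtr_matrix_measurable[OF CC_D(1)[OF assms(1)] assms(2)]
  show ?thesis unfolding gibbs_weight_def[abs_def] by measurable
qed

text \<open>Quadratic bounds on V sandwich the weight between two Gaussian weights. C is any
  positive majorant of \<open>CC_norm V\<close>, later \<open>CC_norm V + 1\<close>, so that
  positivity of the norm itself need not be shown.\<close>

lemma gibbs_partition_bounds:
  fixes V :: "('d::finite) scalar_family"
  assumes V: "V \<in> CC" and N: "N > 0" and a: "a > 0"
    and ge: "\<And>X. X \<in> sa_tuples (matrix_alg N) \<Longrightarrow> Re (V (matrix_alg N) X) \<ge> a * V0 (matrix_alg N) X + b"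
    and C: "C > 0" "CC_norm V \<le> C"
  shows "partition_function V N < \<infinity>"
    and "ennreal (exp (- (real N)\<^sup>2 * C)) * (\<integral>\<^sup>+X. ennreal (exp (- (real N)\<^sup>2 * (C * matrix_V0 N X)))
      \<partial>(lebesgue_sa N :: ('d \<Rightarrow> mat_op) measure)) \<le> partition_function V N"
proof -
  let ?M = "matrix_alg N" and ?L = "lebesgue_sa N :: ('d \<Rightarrow> mat_op) measure"
  let ?G = "\<lambda>c. \<integral>\<^sup>+X. ennreal (exp (- (real N)\<^sup>2 * (c * matrix_V0 N X))) \<partial>?L"
  obtain K where K: "K > 0" "\<And>c. c > 0 \<Longrightarrow> ?G c = ennreal (K * sqrt (1 / c) ^ (CARD('d) * N\<^sup>2))"
    by (rule nn_integral_matrix_gaussian[OF N, where 'd = 'd]) blast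
  have "partition_function V N \<le> (\<integral>\<^sup>+X. ennreal (exp (- (real N)\<^sup>2 * b + - (real N)\<^sup>2 * (a * matrix_V0 N X))) \<partial>?L)"
    unfolding partition_function_def
  proof (rule nn_integral_mono_AE, use AE_lebesgue_sa in eventually_elim)
    case (elim X)
    have "(real N)\<^sup>2 * (a * matrix_V0 N X + b) \<le> (real N)\<^sup>2 * Re (V ?M X)"
      using ge[OF elim] V0_eq_matrix_V0[OF elim] by (intro mult_left_mono) auto
    then show ?case unfolding gibbs_weight_def by (intro ennreal_leI) (simp add: algebra_simps)
  qed
  also have "\<dots> = ennreal (exp (- (real N)\<^sup>2 * b)) * ?G a"
    by (rule nn_integral_exp_affine) measurable
  also have "\<dots> < \<infinity>" using a K by (simp add: ennreal_mult_less_top)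
  finally show "partition_function V N < \<infinity>" .
  have "ennreal (exp (- (real N)\<^sup>2 * C)) * ?G C =
      (\<integral>\<^sup>+X. ennreal (exp (- (real N)\<^sup>2 * C + - (real N)\<^sup>2 * (C * matrix_V0 N X))) \<partial>?L)"
    by (rule nn_integral_exp_affine[symmetric]) measurable
  also have "\<dots> \<le> partition_function V N"
    unfolding partition_function_def
  proof (rule nn_integral_mono_AE, use AE_lebesgue_sa in eventually_elim)
    case (elim X)
    have "Re (V ?M X) \<le> CC_norm V * (1 + matrix_V0 N X)"
      using CC_bound[OF V N elim] complex_Re_le_cmod[of "V ?M X"] V0_eq_matrix_V0[OF elim] by simp
    also have "\<dots> \<le> C * (1 + matrix_V0 N X)"
      using C V0_matrix_nonneg[OF elim] V0_eq_matrix_V0[OF elim] by (intro mult_right_mono) auto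
    finally have "(real N)\<^sup>2 * Re (V ?M X) \<le> (real N)\<^sup>2 * (C * (1 + matrix_V0 N X))"
      by (intro mult_left_mono) auto
    then show ?case unfolding gibbs_weight_def by (intro ennreal_leI) (simp add: algebra_simps)
  qed
  finally show "ennreal (exp (- (real N)\<^sup>2 * C)) * ?G C \<le> partition_function V N" .
qed

lemma space_gibbs_measure [simp]: "space (gibbs_measure V N) = UNIV"
  and sets_gibbs_measure [simp, measurable_cong]: "sets (gibbs_measure V N) = sets borel"
  by (simp_all add: gibbs_measure_def)

lemma emeasure_gibbs_measure:
  assumes "V \<in> CC" "N > 0" "E \<in> sets borel"
  shows "emeasure (gibbs_measure V N) E =
    (\<integral>\<^sup>+X. gibbs_weight V N X * indicator E X \<partial>lebesgue_sa N) / partition_function V N"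
proof -
  note [measurable] = gibbs_weight_measurable[OF assms(1,2)] assms(3)
  have "emeasure (gibbs_measure V N) E =
    (\<integral>\<^sup>+X. gibbs_weight V N X / partition_function V N * indicator E X \<partial>lebesgue_sa N)"
    unfolding gibbs_measure_def partition_function_def[symmetric]
    by (intro emeasure_density) (simp_all add: assms(3))
  also have "\<dots> = (\<integral>\<^sup>+X. gibbs_weight V N X * indicator E X / partition_function V N \<partial>lebesgue_sa N)"
    by (simp add: ennreal_times_divide mult.commute)
  finally show ?thesis by (simp add: nn_integral_divide)
qed

text \<open>The normalized density has mass 1 only if the partition function is neither 0 nor
  \<infinity>; the two Gaussian bounds exclude both.\<close>

lemma prob_space_gibbs_measure:
  fixes V :: "('d::finite) scalar_family"
  assumes V: "V \<in> CC" and N: "N > 0" and a: "a > 0"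
    and ge: "\<And>X. X \<in> sa_tuples (matrix_alg N) \<Longrightarrow> Re (V (matrix_alg N) X) \<ge> a * V0 (matrix_alg N) X + b"
  shows "prob_space (gibbs_measure V N)"
proof
  let ?L = "lebesgue_sa N :: ('d \<Rightarrow> mat_op) measure"
  define C where "C = CC_norm V + 1"
  have C: "C > 0" "CC_norm V \<le> C" using CC_norm_nonneg[of V] by (auto simp: C_def)
  obtain K where K: "K > 0" "\<And>c. c > 0 \<Longrightarrow> (\<integral>\<^sup>+X. ennreal (exp (- (real N)\<^sup>2 * (c * matrix_V0 N X))) \<partial>?L)
      = ennreal (K * sqrt (1 / c) ^ (CARD('d) * N\<^sup>2))"
    by (rule nn_integral_matrix_gaussian[OF N, where 'd = 'd]) blast
  note Z = gibbs_partition_bounds[OF V N a ge C]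
  have "0 < ennreal (exp (- (real N)\<^sup>2 * C)) * ennreal (K * sqrt (1 / C) ^ (CARD('d) * N\<^sup>2))"
    using C K by (simp add: ennreal_zero_less_mult_iff)
  then have "0 < partition_function V N" using Z(2) K(2)[OF C(1)] by simp
  then show "emeasure (gibbs_measure V N) (space (gibbs_measure V N)) = 1"
    using Z(1) emeasure_gibbs_measure[OF V N, of UNIV]
    by (simp add: ennreal_divide_self flip: partition_function_def)
qed

text \<open>Half of the quadratic growth of \<open>V\<close> gives the decay in \<open>R\<close>, the other half is kept for
  integrability. The logarithm comes from the ratio of the Gaussian integrals with parameters
  \<open>a / 2\<close> and \<open>C\<close>.\<close>

lemma gibbs_measure_tail:
  fixes V :: "('d::finite) scalar_family"
  assumes V: "V \<in> CC" and N: "N > 0" and a: "a > 0"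
    and ge: "\<And>X. X \<in> sa_tuples (matrix_alg N) \<Longrightarrow> Re (V (matrix_alg N) X) \<ge> a * V0 (matrix_alg N) X + b"
    and C: "C > 0" "CC_norm V \<le> C"
    and E: "E \<in> sets borel" "\<And>X. X \<in> E \<Longrightarrow> X \<in> sa_tuples (matrix_alg N) \<Longrightarrow> R \<le> V0 (matrix_alg N) X"
  shows "measure (gibbs_measure V N) E \<le>
    exp ((real N)\<^sup>2 * (C - b - a * R / 2 + CARD('d) * ln (sqrt (2 * C / a))))"
proof -
  let ?M = "matrix_alg N" and ?L = "lebesgue_sa N :: ('d \<Rightarrow> mat_op) measure"
  let ?G = "\<lambda>c. \<integral>\<^sup>+X. ennreal (exp (- (real N)\<^sup>2 * (c * matrix_V0 N X))) \<partial>?L"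
  let ?n = "CARD('d) * N\<^sup>2"
  obtain K where K: "K > 0" "\<And>c. c > 0 \<Longrightarrow> ?G c = ennreal (K * sqrt (1 / c) ^ ?n)"
    by (rule nn_integral_matrix_gaussian[OF N, where 'd = 'd]) blast
  define z where "z = exp (- (real N)\<^sup>2 * C) * (K * sqrt (1 / C) ^ ?n)"
  have z: "z > 0" unfolding z_def using C K by simp
  have "ennreal z \<le> partition_function V N"
    using gibbs_partition_bounds(2)[OF V N a ge C] K C by (simp add: z_def ennreal_mult)
  define e where "e = - (real N)\<^sup>2 * (b + a * R / 2)"
  have "(\<integral>\<^sup>+X. gibbs_weight V N X * indicator E X \<partial>?L) \<le>
      (\<integral>\<^sup>+X. ennreal (exp (e + - (real N)\<^sup>2 * ((a / 2) * matrix_V0 N X))) \<partial>?L)"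
  proof (rule nn_integral_mono_AE, use AE_lebesgue_sa in eventually_elim)
    case (elim X)
    show ?case
    proof (cases "X \<in> E")
      case True
      have "a * R \<le> a * matrix_V0 N X"
        using E(2)[OF True elim] V0_eq_matrix_V0[OF elim] a by (intro mult_left_mono) auto
      then have "b + a * R / 2 + a / 2 * matrix_V0 N X \<le> Re (V ?M X)"
        using ge[OF elim] V0_eq_matrix_V0[OF elim] by simp
      then have "(real N)\<^sup>2 * (b + a * R / 2 + a / 2 * matrix_V0 N X) \<le> (real N)\<^sup>2 * Re (V ?M X)"
        by (intro mult_left_mono) auto
      then show ?thesis unfolding gibbs_weight_def e_def using True
        by (auto intro!: ennreal_leI simp: algebra_simps)
    qed simp
  qed
  also have "\<dots> = ennreal (exp e) * ?G (a / 2)"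
    by (rule nn_integral_exp_affine) measurable
  also have "\<dots> = ennreal (exp e * (K * sqrt (1 / (a / 2)) ^ ?n))"
  proof -
    have "a / 2 > 0" using a by simp
    from K(2)[OF this] show ?thesis using K(1) by (simp only: ennreal_mult' exp_ge_zero)
  qed
  finally have num: "(\<integral>\<^sup>+X. gibbs_weight V N X * indicator E X \<partial>?L) \<le>
    ennreal (exp e * (K * sqrt (1 / (a / 2)) ^ ?n))" .
  obtain z' where z': "partition_function V N = ennreal z'" "z \<le> z'"
    using \<open>ennreal z \<le> _\<close> gibbs_partition_bounds(1)[OF V N a ge C] z
    by (cases "partition_function V N") (auto simp: ennreal_le_iff)
  have "emeasure (gibbs_measure V N) E \<le> ennreal (exp e * (K * sqrt (1 / (a / 2)) ^ ?n)) / ennreal z'"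
    unfolding emeasure_gibbs_measure[OF V N E(1)] z'(1) using num by (rule divide_right_mono_ennreal)
  also have "\<dots> = ennreal (exp e * (K * sqrt (1 / (a / 2)) ^ ?n) / z')"
    using z z' K a by (intro divide_ennreal) auto
  finally have "measure (gibbs_measure V N) E \<le> exp e * (K * sqrt (1 / (a / 2)) ^ ?n) / z'"
    unfolding measure_def using z z' K a by (intro enn2real_leI) auto
  also have "\<dots> \<le> exp e * (K * sqrt (1 / (a / 2)) ^ ?n) / z"
    using z z' K a by (intro divide_left_mono mult_pos_pos) auto
  \<comment> \<open>K cancels here, and the two powers merge into one.\<close>
  also have "\<dots> = exp e / exp (- (real N)\<^sup>2 * C) * (sqrt (1 / (a / 2)) / sqrt (1 / C)) ^ ?n"
    unfolding z_def using K by (simp add: power_divide)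
  also have "exp e / exp (- (real N)\<^sup>2 * C) = exp ((real N)\<^sup>2 * (C - b - a * R / 2))"
    by (simp add: e_def algebra_simps flip: exp_diff)
  also have "sqrt (1 / (a / 2)) / sqrt (1 / C) = sqrt (2 * C / a)"
    by (simp flip: real_sqrt_divide)
  also have "sqrt (2 * C / a) ^ ?n = exp ((real N)\<^sup>2 * (CARD('d) * ln (sqrt (2 * C / a))))"
  proof -
    have "exp ((real N)\<^sup>2 * (CARD('d) * ln (sqrt (2 * C / a)))) = exp (of_nat ?n * ln (sqrt (2 * C / a)))"
      by (simp add: mult_ac)
    also have "\<dots> = sqrt (2 * C / a) ^ ?n"
      unfolding exp_of_nat_mult using a C by simp
    finally show ?thesis by simp
  qed
  finally show ?thesis by (simp add: distrib_left flip: exp_add)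
qed

section \<open>Balls of the dual space\<close>

definition dual_ball :: "real \<Rightarrow> (('d::finite) scalar_family \<Rightarrow> complex) set" where
  "dual_ball K = {\<phi> \<in> CC_dual. \<forall>f\<in>CC. cmod (\<phi> f) \<le> K * CC_norm f}"

text \<open>Banach-Alaoglu: linearity and the norm bound are closed conditions on finitely many
  coordinates at a time, so the ball is closed in the product, and it lies in a product of discs,
  which is compact by Tychonoff.\<close>

lemma dual_ball_closed_compact:
  fixes K :: real
  defines "P \<equiv> product_topology (\<lambda>_. euclidean :: complex topology) (CC :: ('d::finite) scalar_family set)"
  shows "closedin P (dual_ball K)" "compactin P (dual_ball K)"
proof -
  have proj: "continuous_map P euclidean (\<lambda>\<phi>. \<phi> f)" if "f \<in> CC" for f :: "'d scalar_family"
    using continuous_map_product_projection[OF that, of "\<lambda>_. euclidean"] by (simp add: P_def)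
  have scale: "continuous_map P euclidean (\<lambda>\<phi>. c * \<phi> f)" if "f \<in> CC" for c and f :: "'d scalar_family"
    using continuous_map_compose[OF proj[OF that], of euclidean "(*) c"]
    by (simp add: comp_def continuous_on_mult_left)
  define S1 where "S1 = (\<lambda>f g. {\<phi> \<in> topspace P. \<phi> (\<lambda>A X. f A X + g A X) - \<phi> f - \<phi> g \<in> {0}})"
  define S2 where "S2 = (\<lambda>c f. {\<phi> \<in> topspace P. \<phi> (\<lambda>A X. c * f A X) - c * \<phi> f \<in> {0}})"
  define S3 where "S3 = (\<lambda>f. {\<phi> \<in> topspace P. \<phi> f \<in> cball 0 (K * CC_norm f)})"
  have 1: "closedin P (S1 f g)" if "f \<in> CC" "g \<in> CC" for f g
    unfolding S1_def using that
    by (intro closedin_continuous_map_preimage[where Y = euclidean] continuous_map_diff proj CC_add) auto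
  have 2: "closedin P (S2 c f)" if "f \<in> CC" for c f
    unfolding S2_def using that
    by (intro closedin_continuous_map_preimage[where Y = euclidean] continuous_map_diff
        scale proj CC_scale) auto
  have 3: "closedin P (S3 f)" if "f \<in> CC" for f
    unfolding S3_def using that
    by (intro closedin_continuous_map_preimage[where Y = euclidean] proj) auto
  \<comment> \<open>Including \<open>topspace P\<close> makes the family visibly nonempty, as
    closedness of the intersection requires, and supplies extensionality.\<close>
  let ?F = "insert (topspace P) ((\<Union>f\<in>CC. \<Union>g\<in>CC. {S1 f g}) \<union> (\<Union>c. \<Union>f\<in>CC. {S2 c f}) \<union> (\<Union>f\<in>CC. {S3 f}))"
  have ext: "topspace P = extensional CC" by (auto simp: P_def PiE_def)
  have "dual_ball K = \<Inter>?F"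
  proof
    show "dual_ball K \<subseteq> \<Inter>?F"
      by (auto simp: dual_ball_def CC_dual_def S1_def S2_def S3_def ext)
    show "\<Inter>?F \<subseteq> dual_ball K"
    proof
      fix \<phi> assume "\<phi> \<in> \<Inter>?F"
      then have "\<phi> \<in> extensional CC" "\<forall>f\<in>CC. \<forall>g\<in>CC. \<phi> \<in> S1 f g" "\<forall>c. \<forall>f\<in>CC. \<phi> \<in> S2 c f"
        "\<forall>f\<in>CC. \<phi> \<in> S3 f" by (simp_all add: ext) blast+
      then have "\<phi> \<in> extensional CC"
        "\<forall>f\<in>CC. \<forall>g\<in>CC. \<phi> (\<lambda>A X. f A X + g A X) = \<phi> f + \<phi> g"
        "\<forall>c. \<forall>f\<in>CC. \<phi> (\<lambda>A X. c * f A X) = c * \<phi> f"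
        "\<forall>f\<in>CC. cmod (\<phi> f) \<le> K * CC_norm f"
        by (simp_all add: S1_def S2_def S3_def algebra_simps)
      then show "\<phi> \<in> dual_ball K" unfolding dual_ball_def CC_dual_def by blast
    qed
  qed
  moreover have "closedin P (\<Inter>?F)"
    by (rule closedin_Inter) (use 1 2 3 in auto)
  ultimately show closed: "closedin P (dual_ball K)" by simp
  have "compactin P (PiE CC (\<lambda>f. cball 0 (K * CC_norm f)))"
    unfolding P_def compactin_PiE by simp
  then show "compactin P (dual_ball K)"
    by (rule closed_compactin[OF _ _ closed])
       (auto simp: dual_ball_def CC_dual_def PiE_def)
qed

lemma compactin_dual_ball: "compactin weak_star (dual_ball K)"
  unfolding weak_star_def compactin_subtopology
  by (simp add: dual_ball_closed_compact) (auto simp: dual_ball_def)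

lemma openin_compl_dual_ball: "openin weak_star (CC_dual - dual_ball K)"
proof -
  have "dual_ball K = dual_ball K \<inter> CC_dual" by (auto simp: dual_ball_def)
  then have "closedin weak_star (dual_ball K)"
    unfolding weak_star_def closedin_subtopology using dual_ball_closed_compact(1) by blast
  then show ?thesis using closedin_def topspace_weak_star by metis
qed

text \<open>Used in contrapositive form: if the law is outside the ball of radius 1 + R, then V0(X)
  > R and the tail estimate applies.\<close>

lemma law_functional_dual_ball:
  assumes N: "N > 0" and X: "X \<in> sa_tuples (matrix_alg N)" and "1 + V0 (matrix_alg N) X \<le> K"
  shows "law_functional (matrix_alg N) X \<in> dual_ball K"
proof -
  have "cmod (f (matrix_alg N) X) \<le> K * CC_norm f" if f: "f \<in> CC" for f
  proof -
    have "cmod (f (matrix_alg N) X) \<le> (1 + V0 (matrix_alg N) X) * CC_norm f"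
      using CC_bound[OF f N X] by (simp add: mult.commute)
    also have "\<dots> \<le> K * CC_norm f" using assms(3) CC_norm_nonneg by (rule mult_right_mono)
    finally show ?thesis .
  qed
  then show ?thesis
    using law_functional_in_CC_dual[OF N X] by (simp add: dual_ball_def law_functional_def)
qed


section \<open>Exponential rates along an ultrafilter\<close>

text \<open>For a below the Limsup, the set where f \<le> a is not in the ultrafilter, since
  otherwise the Limsup would be at most a; so its complement is.\<close>

lemma ultrafilter_tendsto_Limsup:
  fixes f :: "'b \<Rightarrow> 'c::{complete_linorder, linorder_topology}"
  assumes "\<And>P. eventually P \<omega> \<or> eventually (\<lambda>n. \<not> P n) \<omega>"
  shows "(f \<longlongrightarrow> Limsup \<omega> f) \<omega>"
proof (rule order_tendstoI)
  fix a assume a: "a < Limsup \<omega> f"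
  have "\<not> eventually (\<lambda>n. \<not> a < f n) \<omega>"
  proof
    assume "eventually (\<lambda>n. \<not> a < f n) \<omega>"
    then have "Limsup \<omega> f \<le> a" by (intro Limsup_bounded) (simp add: not_less)
    with a show False by simp
  qed
  then show "eventually (\<lambda>n. a < f n) \<omega>" using assms by blast
next
  fix a assume "Limsup \<omega> f < a"
  then show "eventually (\<lambda>n. f n < a) \<omega>" by (rule Limsup_lessD)
qed

text \<open>Deleting one point at a time shows that all final segments belong to \<omega>. Ordinary
  limits as N grows therefore hold along \<omega>.\<close>

lemma nonprincipal_ultrafilter_le_sequentially:
  assumes "nonprincipal_ultrafilter \<omega>"
  shows "\<omega> \<le> sequentially"
proof (rule filter_leI)
  fix P :: "nat \<Rightarrow> bool" assume "eventually P sequentially"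
  then obtain m where m: "\<And>n. n \<ge> m \<Longrightarrow> P n" by (auto simp: eventually_sequentially)
  have "eventually (\<lambda>n. n \<ge> m) \<omega>" for m
  proof (induction m)
    case (Suc m)
    have "eventually (\<lambda>n. n \<noteq> m) \<omega>" using assms by (auto simp: nonprincipal_ultrafilter_def)
    with Suc show ?case by eventually_elim simp
  qed simp
  from this[of m] show "eventually P \<omega>" by eventually_elim (rule m)
qed

text \<open>For N = 0 the factor would be 0 and turn the value -\<infinity> at p = 0 into 0.\<close>

lemma scaled_ext_log_le:
  assumes "N > 0" "p \<le> exp ((real N)\<^sup>2 * r)"
  shows "ereal (1 / (real N)\<^sup>2) * ext_log p \<le> ereal r"
proof (cases "p \<le> 0")
  case True
  then show ?thesis using assms(1) by (simp add: ext_log_def)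
next
  case False
  then have "ln p \<le> (real N)\<^sup>2 * r" using assms(2)
    by (metis exp_gt_zero ln_exp ln_le_cancel_iff not_le)
  then show ?thesis using False assms(1) by (simp add: ext_log_def field_simps)
qed

lemma scaled_ext_log_less:
  assumes "N > 0" "ereal (1 / (real N)\<^sup>2) * ext_log p < ereal r"
  shows "p \<le> exp ((real N)\<^sup>2 * r)"
proof (cases "p \<le> 0")
  case True
  then show ?thesis by (meson exp_ge_zero order_trans)
next
  case False
  then have "ln p < (real N)\<^sup>2 * r" using assms by (simp add: ext_log_def field_simps)
  then have "exp (ln p) \<le> exp ((real N)\<^sup>2 * r)" by (simp del: exp_ln)
  with False show ?thesis by simp
qed

section \<open>Rates for a fixed coercive potential\<close>

locale coercive_potential =
  fixes V :: "('d::finite) scalar_family" and \<omega> :: "nat filter" and a b :: real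
  assumes V_CC: "V \<in> CC"
    and a_pos: "a > 0"
    and V_ge: "\<And>A X. A \<in> WW \<Longrightarrow> X \<in> sa_tuples A \<Longrightarrow> Re (V A X) \<ge> a * V0 A X + b"
    and omega: "nonprincipal_ultrafilter \<omega>"
begin

lemma omega_not_bot: "\<omega> \<noteq> bot"
  using omega by (simp add: nonprincipal_ultrafilter_def)

lemma eventually_pos: "eventually (\<lambda>N. N > 0) \<omega>"
  using nonprincipal_ultrafilter_le_sequentially[OF omega] eventually_gt_at_top[of 0]
  by (rule filter_leD)

lemma V_ge_matrix:
  "N > 0 \<Longrightarrow> X \<in> sa_tuples (matrix_alg N) \<Longrightarrow> Re (V (matrix_alg N) X) \<ge> a * V0 (matrix_alg N) X + b"
  by (intro V_ge matrix_alg_in_WW)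

lemma prob_space_gibbs: "N > 0 \<Longrightarrow> prob_space (gibbs_measure V N)"
  using prob_space_gibbs_measure[OF V_CC _ a_pos V_ge_matrix] by blast

lemma log_rate_eq_Limsup:
  "log_rate \<omega> V U =
    Limsup \<omega> (\<lambda>N. ereal (1 / (real N)\<^sup>2) * ext_log (measure (gibbs_measure V N) (microstates N U)))"
  unfolding log_rate_def
  using omega by (intro tendsto_Lim omega_not_bot ultrafilter_tendsto_Limsup)
    (simp add: nonprincipal_ultrafilter_def)

text \<open>The strict form leaves room for a real r between both rates and m, even if the rates are
  -\<infinity>.\<close>

lemma log_rate_Un_less:
  assumes "openin weak_star U" "openin weak_star U'"
    and "log_rate \<omega> V U < m" "log_rate \<omega> V U' < m"
  shows "log_rate \<omega> V (U \<union> U') < m"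
proof -
  from assms(3,4) have "max (log_rate \<omega> V U) (log_rate \<omega> V U') < m" by simp
  then obtain r where r: "log_rate \<omega> V U < ereal r" "log_rate \<omega> V U' < ereal r" "ereal r < m"
    using ereal_dense2 by (metis max_less_iff_conj)
  have "eventually (\<lambda>N. ereal (1 / (real N)\<^sup>2) * ext_log (measure (gibbs_measure V N) (microstates N (U \<union> U')))
    \<le> ereal (ln 2 / (real N)\<^sup>2 + r)) \<omega>"
    using eventually_pos r(1,2)[unfolded log_rate_eq_Limsup, THEN Limsup_lessD]
  proof eventually_elim
    case (elim N)
    interpret prob_space "gibbs_measure V N" using elim(1) by (rule prob_space_gibbs)
    have "prob (microstates N (U \<union> U')) = prob (microstates N U \<union> microstates N U')"
      by (rule arg_cong[of _ _ prob]) (auto simp: microstates_def)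
    also have "\<dots> \<le> prob (microstates N U) + prob (microstates N U')"
      using assms(1,2) elim(1) by (intro measure_Un_le) (simp_all add: microstates_borel)
    also have "\<dots> \<le> exp ((real N)\<^sup>2 * r) + exp ((real N)\<^sup>2 * r)"
      using elim by (intro add_mono scaled_ext_log_less)
    \<comment> \<open>The factor 2 is moved into the rate as ln 2 / N^2, which tends to 0 along
      \<omega>.\<close>
    also have "\<dots> = exp ((real N)\<^sup>2 * (ln 2 / (real N)\<^sup>2 + r))"
      using elim(1) by (simp add: distrib_left exp_add)
    finally show ?case using elim(1) by (intro scaled_ext_log_le)
  qed
  then have "log_rate \<omega> V (U \<union> U') \<le> Limsup \<omega> (\<lambda>N. ereal (ln 2 / (real N)\<^sup>2 + r))"
    unfolding log_rate_eq_Limsup by (rule Limsup_mono)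
  also have "\<dots> = ereal r"
  proof (rule lim_imp_Limsup[OF omega_not_bot])
    have "(\<lambda>N. ln 2 * (inverse (real N))\<^sup>2 + r) \<longlonglongrightarrow> ln 2 * 0\<^sup>2 + r"
      by (intro tendsto_intros lim_inverse_n)
    then have "(\<lambda>N. ereal (ln 2 / (real N)\<^sup>2 + r)) \<longlonglongrightarrow> ereal r"
      by (simp add: divide_inverse power_inverse)
    then show "((\<lambda>N. ereal (ln 2 / (real N)\<^sup>2 + r)) \<longlongrightarrow> ereal r) \<omega>"
      using nonprincipal_ultrafilter_le_sequentially[OF omega] by (rule tendsto_mono[rotated])
  qed
  finally show ?thesis using r(3) by simp
qed

lemma log_rate_Union_less:
  assumes "finite \<U>" "\<And>U. U \<in> \<U> \<Longrightarrow> openin weak_star U \<and> log_rate \<omega> V U < m"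
    and "openin weak_star W" "log_rate \<omega> V W < m"
  shows "log_rate \<omega> V (W \<union> \<Union>\<U>) < m"
  using assms(1,2)
proof (induction \<U>)
  case empty
  then show ?case using assms(4) by simp
next
  case (insert U \<U>)
  then have "log_rate \<omega> V (U \<union> (W \<union> \<Union>\<U>)) < m"
    using assms(3) by (intro log_rate_Un_less[of U "W \<union> \<Union>\<U>"]) (auto intro!: openin_Un openin_Union)
  then show ?case by (simp add: Un_left_commute)
qed

text \<open>Almost every tuple is self-adjoint and its law is a bounded functional, so the event has
  probability 1 for every N > 0.\<close>

lemma log_rate_CC_dual: "log_rate \<omega> V CC_dual = 0"
proof -
  have "eventually (\<lambda>N. ereal (1 / (real N)\<^sup>2) * ext_log (measure (gibbs_measure V N) (microstates N CC_dual)) = 0) \<omega>"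
    using eventually_pos
  proof eventually_elim
    case (elim N)
    interpret prob_space "gibbs_measure V N" using elim by (rule prob_space_gibbs)
    note [measurable] = gibbs_weight_measurable[OF V_CC elim]
    have "AE X in gibbs_measure V N. X \<in> sa_tuples (matrix_alg N)"
      unfolding gibbs_measure_def using AE_lebesgue_sa[of N]
      by (subst AE_density) (simp_all, erule eventually_mono, simp)
    then have "prob (sa_tuples (matrix_alg N)) = 1"
      by (subst prob_eq_1) (simp_all add: borel_closed closed_sa_tuples_matrix)
    moreover have "microstates N CC_dual = (sa_tuples (matrix_alg N) :: ('d \<Rightarrow> mat_op) set)"
      using law_functional_in_CC_dual[OF elim] by (auto simp: microstates_def)
    ultimately show ?case by (simp add: ext_log_def)
  qed
  then have "log_rate \<omega> V CC_dual = Limsup \<omega> (\<lambda>N. 0)"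
    unfolding log_rate_eq_Limsup by (rule Limsup_eq)
  then show ?thesis by (simp add: Limsup_const omega_not_bot)
qed

lemma exponentially_tight:
  obtains K where "log_rate \<omega> V (CC_dual - dual_ball K) \<le> ereal r"
proof
  define C where "C = CC_norm V + 1"
  have C: "C > 0" "CC_norm V \<le> C" using CC_norm_nonneg[of V] by (auto simp: C_def)
  \<comment> \<open>Chosen so that the exponent in the tail estimate equals r.\<close>
  define R where "R = 2 * (C - b + CARD('d) * ln (sqrt (2 * C / a)) - r) / a"
  let ?U = "CC_dual - dual_ball (1 + R) :: ('d scalar_family \<Rightarrow> complex) set"
  have exponent: "C - b - a * R / 2 + CARD('d) * ln (sqrt (2 * C / a)) = r"
  proof -
    have "a * R / 2 = C - b + CARD('d) * ln (sqrt (2 * C / a)) - r" using a_pos by (simp add: R_def)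
    then show ?thesis by linarith
  qed
  have "eventually (\<lambda>N. ereal (1 / (real N)\<^sup>2) * ext_log (measure (gibbs_measure V N) (microstates N ?U)) \<le> ereal r) \<omega>"
    using eventually_pos
  proof eventually_elim
    case (elim N)
    have "R \<le> V0 (matrix_alg N) X" if "X \<in> microstates N ?U" for X
      using that law_functional_dual_ball[OF elim, of X "1 + R"] by (force simp: microstates_def)
    then have "measure (gibbs_measure V N) (microstates N ?U) \<le> exp ((real N)\<^sup>2 * r)"
      using gibbs_measure_tail[OF V_CC elim a_pos V_ge_matrix C microstates_borel[OF openin_compl_dual_ball elim]]
        elim exponent by auto
    with elim show ?case by (rule scaled_ext_log_le)
  qed
  then show "log_rate \<omega> V ?U \<le> ereal r"
    unfolding log_rate_eq_Limsup by (rule Limsup_bounded)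
qed

text \<open>Every neighborhood of \<F> is one of \<nu>, so the infimum on the right runs over fewer
  sets.\<close>

lemma chi_le_log_rate_Inf:
  assumes "\<nu> \<in> \<F>"
  shows "chi \<omega> V \<nu> \<le> (INF \<U>\<in>{\<U>. openin weak_star \<U> \<and> \<F> \<subseteq> \<U>}. log_rate \<omega> V \<U>)"
  unfolding chi_def using assms by (intro INF_superset_mono) auto

lemma chi_attains_log_rate_Inf:
  assumes F: "closedin weak_star \<F>" "\<F> \<noteq> {}"
  shows "\<exists>\<nu>\<in>\<F>. (INF \<U>\<in>{\<U>. openin weak_star \<U> \<and> \<F> \<subseteq> \<U>}. log_rate \<omega> V \<U>) \<le> chi \<omega> V \<nu>"
    (is "\<exists>\<nu>\<in>\<F>. ?m \<le> _")
proof (rule ccontr)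
  assume "\<not> ?thesis"
  then have less: "chi \<omega> V \<nu> < ?m" if "\<nu> \<in> \<F>" for \<nu> using that by (auto simp: not_le)
  \<comment> \<open>Since \<F> is nonempty, some value of \<open>chi\<close> lies strictly below
    \<open>?m\<close>; hence \<open>?m\<close> is not -\<infinity> and a real number fits under
    it.\<close>
  with F(2) obtain \<nu> where "chi \<omega> V \<nu> < ?m" by blast
  then obtain r where r: "ereal r < ?m" using ereal_dense2 by blast
  obtain K where K: "log_rate \<omega> V (CC_dual - dual_ball K) \<le> ereal r"
    by (rule exponentially_tight)
  let ?C = "{U. openin weak_star U \<and> log_rate \<omega> V U < ?m}"
  have "\<F> \<inter> dual_ball K \<subseteq> \<Union>?C"
  proof
    fix \<nu> assume "\<nu> \<in> \<F> \<inter> dual_ball K"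
    then have "chi \<omega> V \<nu> < ?m" using less by blast
    then show "\<nu> \<in> \<Union>?C" unfolding chi_def INF_less_iff by blast
  qed
  moreover have "compactin weak_star (\<F> \<inter> dual_ball K)"
    using F(1) compactin_dual_ball by (rule closed_Int_compactin)
  ultimately obtain \<U> where U: "finite \<U>" "\<U> \<subseteq> ?C" "\<F> \<inter> dual_ball K \<subseteq> \<Union>\<U>"
    using compactinD[of weak_star "\<F> \<inter> dual_ball K" ?C] by blast
  let ?W = "(CC_dual - dual_ball K) \<union> \<Union>\<U>"
  have "log_rate \<omega> V ?W < ?m"
    using U(1,2) K r openin_compl_dual_ball by (intro log_rate_Union_less) (auto intro: order.strict_trans1)
  moreover have "openin weak_star ?W"
    using U(2) openin_compl_dual_ball by (intro openin_Un openin_Union) auto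
  moreover have "\<F> \<subseteq> ?W" using closedin_subset[OF F(1)] U(3) by auto
  then have "?m \<le> log_rate \<omega> V ?W" using \<open>openin weak_star ?W\<close> by (intro INF_lower) simp
  ultimately show False by simp
qed

lemma chi_attains_max:
  assumes "closedin weak_star \<F>" "\<F> \<noteq> {}"
  shows "\<exists>\<nu>\<in>\<F>. (\<forall>\<nu>'\<in>\<F>. chi \<omega> V \<nu>' \<le> chi \<omega> V \<nu>) \<and>
    (INF \<U>\<in>{\<U>. openin weak_star \<U> \<and> \<F> \<subseteq> \<U>}. log_rate \<omega> V \<U>) = chi \<omega> V \<nu>"
  using chi_attains_log_rate_Inf[OF assms] chi_le_log_rate_Inf order.trans antisym by meson

text \<open>The only open set containing the whole space is the space itself, so the infimum is the
  rate of an event of probability 1. The zero functional witnesses nonemptiness.\<close>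

lemma chi_max_CC_dual: "\<exists>\<nu>\<in>CC_dual. (\<forall>\<nu>'\<in>CC_dual. chi \<omega> V \<nu>' \<le> chi \<omega> V \<nu>) \<and> chi \<omega> V \<nu> = 0"
proof -
  have "(\<lambda>f\<in>CC. 0) \<in> (CC_dual :: ('d scalar_family \<Rightarrow> complex) set)"
    by (auto simp: CC_dual_def CC_add CC_scale intro!: exI[of _ 0])
  then have "(CC_dual :: ('d scalar_family \<Rightarrow> complex) set) \<noteq> {}" by blast
  moreover have "closedin weak_star (CC_dual :: ('d scalar_family \<Rightarrow> complex) set)"
    using closedin_topspace[of "weak_star :: ('d scalar_family \<Rightarrow> complex) topology"] by simp
  moreover have "{\<U>. openin weak_star \<U> \<and> CC_dual \<subseteq> \<U>} = {CC_dual :: ('d scalar_family \<Rightarrow> complex) set}"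
    using openin_subset[of "weak_star :: ('d scalar_family \<Rightarrow> complex) topology"]
      openin_topspace[of "weak_star :: ('d scalar_family \<Rightarrow> complex) topology"] by auto
  ultimately show ?thesis using chi_attains_max[of CC_dual] log_rate_CC_dual by auto
qed

end

theorem proposition7p11:
  fixes V :: "('d::finite) scalar_family" and \<omega> :: "nat filter" and a b :: real
  assumes V_CC: "V \<in> CC"
    and V_real: "\<And>A X. A \<in> WW \<Longrightarrow> X \<in> sa_tuples A \<Longrightarrow> V A X \<in> \<real>"
    and a_pos: "a > 0"
    and V_ge: "\<And>A X. A \<in> WW \<Longrightarrow> X \<in> sa_tuples A \<Longrightarrow> Re (V A X) \<ge> a * V0 A X + b"
    and omega: "nonprincipal_ultrafilter \<omega>"
  shows "(\<forall>\<F>. closedin weak_star \<F> \<and> \<F> \<noteq> {} \<longrightarrow>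
           (\<exists>\<nu>\<in>\<F>. (\<forall>\<nu>'\<in>\<F>. chi \<omega> V \<nu>' \<le> chi \<omega> V \<nu>) \<and>
              (INF \<U>\<in>{\<U>. openin weak_star \<U> \<and> \<F> \<subseteq> \<U>}. log_rate \<omega> V \<U>) = chi \<omega> V \<nu>))
         \<and> (\<exists>\<nu>\<in>CC_dual. (\<forall>\<nu>'\<in>CC_dual. chi \<omega> V \<nu>' \<le> chi \<omega> V \<nu>) \<and> chi \<omega> V \<nu> = 0)
         \<and> (\<exists>\<nu>. free_Gibbs_law \<omega> V \<nu>)"
proof -
  interpret coercive_potential V \<omega> a b
    using V_CC a_pos V_ge omega by unfold_locales
  show ?thesis
    using chi_attains_max chi_max_CC_dual unfolding free_Gibbs_law_def by blast
qed

end
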